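(* Let $G$ be a second-countable locally compact abelian group with Haar measure $\mu$. If $d\geq2$ is an integer and $p$ is a positive integer, then $f\mapsto[|f|]_{\mathrm{U}^{d,p}(G)}$ is a norm on the vector space of $\mu$-a.e. equivalence classes of complex measurable functions $f$ on $G$ such that $[|f|]_{\mathrm{U}^{d,p}(G)}<\infty$. If $d\geq1$ is an integer and $p$ is an even positive integer, then $f\mapsto[f]_{\mathrm{U}^{d,p}(G)}$ is also a norm on the same vector space (that of $\mu$-a.e. equivalence classes of complex measurable functions $f$ with $[|f|]_{\mathrm{U}^{d,p}(G)}<\infty$).
   Context: For a complex measurable $f$ on $G$ and an integer $d\geq1$, define \[ R_d f(h_1,\ldots,h_d) := \int_G \prod_{(\omega_1,\ldots,\omega_d)\in\{0,1\}^d} \mathcal{C}^{d-(\omega_1+\cdots+\omega_d)} f\bigl(x+\omega_1h_1+\cdots+\omega_dh_d\bigr)\,d\mu(x), \] where $\mathcal{C}z=\overline{z}$ is complex conjugation (so $\mathcal{C}^2$ is the identity). For nonnegative $f$ this is interpreted as an element of $[0,\infty]$; for complex $f$ it is defined when the integral exists for a.e. $(h_1,\ldots,h_d)\in G^d$. For $p\in(0,\infty)$, \[ [f]_{\mathrm{U}^{d,p}(G)} := \|R_d f\|_{\mathrm{L}^p(G^d)}^{1/2^d} = \Bigl(\int_{G^d}|R_df|^p\,d\mu^d\Bigr)^{1/(2^dp)}, \] with $\mu^d$ the product measure on $G^d$. *)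

theory Defs
  imports "HOL-Analysis.Analysis" "HOL-Algebra.Module"
begin

text \<open>
  A Haar measure is a nonzero translation-invariant Radon measure on the Borel sets.  (On a
  second-countable locally compact Hausdorff space the two regularity clauses follow from finiteness
  on compact sets.)
\<close>

definition haar_measure :: "'a::{topological_ab_group_add, t2_space} measure \<Rightarrow> bool" where
  "haar_measure \<mu> \<longleftrightarrow>
     sets \<mu> = sets borel \<and>
     emeasure \<mu> UNIV \<noteq> 0 \<and>
     (\<forall>a. \<forall>A \<in> sets borel. emeasure \<mu> ((\<lambda>x. a + x) ` A) = emeasure \<mu> A) \<and>
     (\<forall>K. compact K \<longrightarrow> emeasure \<mu> K < \<infinity>) \<and>
     (\<forall>A \<in> sets borel. emeasure \<mu> A = (INF U \<in> {U. open U \<and> A \<subseteq> U}. emeasure \<mu> U)) \<and>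
     (\<forall>U. open U \<longrightarrow> emeasure \<mu> U = (SUP K \<in> {K. compact K \<and> K \<subseteq> U}. emeasure \<mu> K))"

text \<open>
  Points of \<open>G\<^sup>d\<close> are functions on \<open>{..<d}\<close>, and \<open>\<omega> \<in> {0,1}\<^sup>d\<close> is identified with its
  support \<open>S \<subseteq> {..<d}\<close>, so that \<open>card S\<close> is the sum of the \<open>\<omega>\<^sub>i\<close> and \<open>\<Sum>i\<in>S. h i\<close> is the sum
  of the \<open>\<omega>\<^sub>i h\<^sub>i\<close>.
\<close>

abbreviation prod_measure :: "nat \<Rightarrow> 'a measure \<Rightarrow> (nat \<Rightarrow> 'a) measure" where
  "prod_measure d \<mu> \<equiv> PiM {..<d} (\<lambda>_. \<mu>)"

definition cube_prod :: "nat \<Rightarrow> ('a::ab_group_add \<Rightarrow> complex) \<Rightarrow> (nat \<Rightarrow> 'a) \<Rightarrow> 'a \<Rightarrow> complex" where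
  "cube_prod d f h x = (\<Prod>S \<in> Pow {..<d}. (cnj ^^ (d - card S)) (f (x + (\<Sum>i\<in>S. h i))))"

text \<open>
  \<open>R_op\<close> is only meaningful at those \<open>h\<close> for which \<open>cube_prod d f h\<close> is integrable; elsewhere the
  Bochner integral returns the dummy value 0.  \<open>R_op_nn\<close> is the \<open>[0,\<infinity>]\<close>-valued version for
  nonnegative functions, on which conjugation acts trivially.
\<close>

definition R_op ::
  "'a::ab_group_add measure \<Rightarrow> nat \<Rightarrow> ('a \<Rightarrow> complex) \<Rightarrow> (nat \<Rightarrow> 'a) \<Rightarrow> complex" where
  "R_op \<mu> d f h = (LINT x|\<mu>. cube_prod d f h x)"

definition R_op_nn ::
  "'a::ab_group_add measure \<Rightarrow> nat \<Rightarrow> ('a \<Rightarrow> ennreal) \<Rightarrow> (nat \<Rightarrow> 'a) \<Rightarrow> ennreal" where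
  "R_op_nn \<mu> d f h = (\<integral>\<^sup>+ x. (\<Prod>S \<in> Pow {..<d}. f (x + (\<Sum>i\<in>S. h i))) \<partial>\<mu>)"

text \<open>Used for exponents \<open>a > 0\<close> only.\<close>

definition ennreal_powr :: "ennreal \<Rightarrow> real \<Rightarrow> ennreal" where
  "ennreal_powr x a = (if x = \<infinity> then \<infinity> else ennreal (enn2real x powr a))"

definition U_norm ::
  "'a::ab_group_add measure \<Rightarrow> nat \<Rightarrow> real \<Rightarrow> ('a \<Rightarrow> complex) \<Rightarrow> ennreal" where
  "U_norm \<mu> d p f =
     ennreal_powr (\<integral>\<^sup>+ h. ennreal (cmod (R_op \<mu> d f h) powr p) \<partial>prod_measure d \<mu>)
       (1 / (2 ^ d * p))"

definition U_norm_nn ::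
  "'a::ab_group_add measure \<Rightarrow> nat \<Rightarrow> real \<Rightarrow> ('a \<Rightarrow> ennreal) \<Rightarrow> ennreal" where
  "U_norm_nn \<mu> d p f =
     ennreal_powr (\<integral>\<^sup>+ h. ennreal_powr (R_op_nn \<mu> d f h) p \<partial>prod_measure d \<mu>)
       (1 / (2 ^ d * p))"

abbreviation U_norm_abs ::
  "'a::ab_group_add measure \<Rightarrow> nat \<Rightarrow> real \<Rightarrow> ('a \<Rightarrow> complex) \<Rightarrow> ennreal" where
  "U_norm_abs \<mu> d p f \<equiv> U_norm_nn \<mu> d p (\<lambda>x. ennreal (cmod (f x)))"

definition U_finite ::
  "'a::ab_group_add measure \<Rightarrow> nat \<Rightarrow> real \<Rightarrow> ('a \<Rightarrow> complex) set" where
  "U_finite \<mu> d p = {f \<in> borel_measurable \<mu>. U_norm_abs \<mu> d p f < \<infinity>}"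

definition complex_field :: "complex ring" where
  "complex_field = \<lparr>carrier = UNIV, monoid.mult = (*), one = 1, ring.zero = 0, add = (+)\<rparr>"

definition ae_eq :: "'a measure \<Rightarrow> (('a \<Rightarrow> complex) \<times> ('a \<Rightarrow> complex)) set" where
  "ae_eq M = {(f, g). f \<in> borel_measurable M \<and> g \<in> borel_measurable M \<and> (AE x in M. f x = g x)}"

text \<open>
  The classes of the functions in \<open>F\<close>, with the operations defined on representatives.  The
  record fields \<open>mult\<close> and \<open>one\<close> play no role in a module.
\<close>

definition ae_classes ::
  "'a measure \<Rightarrow> ('a \<Rightarrow> complex) set \<Rightarrow> (complex, ('a \<Rightarrow> complex) set) module" where
  "ae_classes M F =
     \<lparr>carrier = F // ae_eq M,
      monoid.mult = undefined,
      one = undefined,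
      ring.zero = ae_eq M `` {\<lambda>_. 0},
      add = (\<lambda>A B. \<Union>f\<in>A. \<Union>g\<in>B. ae_eq M `` {\<lambda>x. f x + g x}),
      smult = (\<lambda>c A. \<Union>f\<in>A. ae_eq M `` {\<lambda>x. c * f x})\<rparr>"

definition is_norm :: "(complex, 'v, 'm) module_scheme \<Rightarrow> ('v \<Rightarrow> real) \<Rightarrow> bool" where
  "is_norm V \<nu> \<longleftrightarrow>
     Module.module complex_field V \<and>
     (\<forall>v \<in> carrier V. 0 \<le> \<nu> v \<and> (\<nu> v = 0 \<longleftrightarrow> v = \<zero>\<^bsub>V\<^esub>)) \<and>
     (\<forall>c. \<forall>v \<in> carrier V. \<nu> (c \<odot>\<^bsub>V\<^esub> v) = cmod c * \<nu> v) \<and>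
     (\<forall>v \<in> carrier V. \<forall>w \<in> carrier V. \<nu> (v \<oplus>\<^bsub>V\<^esub> w) \<le> \<nu> v + \<nu> w)"

text \<open>
  \<open>f \<mapsto> N f\<close> is a norm on the vector space of classes of the functions in \<open>F\<close>: its value is finite
  and independent of the representative, and the induced functional is a norm.
\<close>

definition norm_on_ae_classes ::
  "'a measure \<Rightarrow> ('a \<Rightarrow> complex) set \<Rightarrow> (('a \<Rightarrow> complex) \<Rightarrow> ennreal) \<Rightarrow> bool" where
  "norm_on_ae_classes M F N \<longleftrightarrow>
     (\<exists>\<nu>. is_norm (ae_classes M F) \<nu> \<and> (\<forall>A \<in> F // ae_eq M. \<forall>f \<in> A. N f = ennreal (\<nu> A)))"

end

theory Submission
  imports Defs
begin

text \<open>
  Everything rests on a Cauchy--Schwarz inequality on \<open>G\<close> alone.  For the correlation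
  \<open>(a \<star> b)(t) = \<integral> cnj (a x) * b (x + t)\<close>, write \<open>\<bar>(a \<star> b)(t)\<bar>\<^sup>p\<close> as an integral over \<open>p\<close> copies of
  \<open>G\<close> (this is where \<open>p\<close> has to be even for complex functions), single out one variable \<open>x\<close> and
  substitute \<open>y\<^sub>j + x\<close> for the others.  Integrating in \<open>t\<close> decouples \<open>a\<close> from \<open>b\<close> and gives
  \<open>\<integral>\<bar>a \<star> b\<bar>\<^sup>p = \<integral> P a y * cnj (P b y)\<close> over \<open>y \<in> G\<^sup>p\<^sup>-\<^sup>1\<close>, whence \<open>\<parallel>a \<star> b\<parallel>\<^sub>p\<^sup>2 \<le> \<parallel>a \<star> a\<parallel>\<^sub>p \<parallel>b \<star> b\<parallel>\<^sub>p\<close>.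
  Applied in each of the \<open>d\<close> directions of the cube this is a Gowers--Cauchy--Schwarz inequality for
  families of functions indexed by the vertices, and the triangle inequality follows by expanding
  \<open>R (f + g)\<close> multilinearly.

  Definiteness is by induction on \<open>d\<close>: \<open>R\<close> in dimension \<open>d + 1\<close> is \<open>R\<close> in dimension \<open>d\<close> of
  \<open>cnj (f x) * f (x + t)\<close>, and if these functions vanish for almost every \<open>t\<close> then \<open>(\<integral>\<bar>f\<bar>)\<^sup>2 = 0\<close>.  For
  complex \<open>f\<close> the induction starts at \<open>d = 1\<close>, where Cauchy--Schwarz makes \<open>f\<close> orthogonal to
  almost all translates of every open set of finite measure.
\<close>

section \<open>Correlations on a group with invariant measure\<close>

text \<open>Invariance is stated through \<open>distr\<close>, so that changes of variables in
  integrals come directly from the image measure. Local compactness is added in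
  \<open>haar_space\<close>, where the complex functional is shown to be definite.\<close>

locale translation_invariant_measure = sigma_finite_measure \<mu>
  for \<mu> :: "'a::{topological_ab_group_add, second_countable_topology, t2_space} measure" +
  assumes sets_eq_borel [measurable_cong]: "sets \<mu> = sets borel"
    and distr_translation: "\<And>a. distr \<mu> borel (\<lambda>x. x + a) = \<mu>"
begin

sublocale P: product_sigma_finite "\<lambda>_::nat. \<mu>"
  by unfold_locales

sublocale pair: pair_sigma_finite \<mu> \<mu>
  by unfold_locales

lemma space_eq_UNIV [simp]: "space \<mu> = UNIV"
  using sets_eq_imp_space_eq[OF sets_eq_borel] by simp

lemma nn_integral_translation:
  assumes [measurable]: "f \<in> borel_measurable borel"
  shows "(\<integral>\<^sup>+x. f (x + a) \<partial>\<mu>) = (\<integral>\<^sup>+x. f x \<partial>\<mu>)"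
  using nn_integral_distr[of "\<lambda>x. x + a" \<mu> borel f] by (simp add: distr_translation)

lemma integral_translation:
  fixes f :: "'a \<Rightarrow> 'b::{banach, second_countable_topology}"
  assumes [measurable]: "f \<in> borel_measurable borel"
  shows "(LINT x|\<mu>. f (x + a)) = (LINT x|\<mu>. f x)"
  using integral_distr[of "\<lambda>x. x + a" \<mu> borel f] by (simp add: distr_translation)

lemma integrable_translation_iff:
  fixes f :: "'a \<Rightarrow> 'b::{banach, second_countable_topology}"
  assumes [measurable]: "f \<in> borel_measurable borel"
  shows "integrable \<mu> (\<lambda>x. f (x + a)) \<longleftrightarrow> integrable \<mu> f"
  using integrable_distr_eq[of "\<lambda>x. x + a" \<mu> borel f] by (simp add: distr_translation)

lemma AE_translation:
  assumes "AE x in \<mu>. P x"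
  shows "AE x in \<mu>. P (x + a)"
proof -
  have "(\<lambda>x. x + a) \<in> measurable \<mu> borel" by measurable
  from AE_distrD[OF this, unfolded distr_translation, OF assms] show ?thesis .
qed

lemma pair_sigma_finite_PiM: "finite I \<Longrightarrow> pair_sigma_finite \<mu> (PiM I (\<lambda>_::nat. \<mu>))"
  by (intro pair_sigma_finite.intro P.sigma_finite sigma_finite_measure_axioms)

lemma nn_integral_commute_PiM:
  assumes "finite I" "case_prod f \<in> borel_measurable (\<mu> \<Otimes>\<^sub>M PiM I (\<lambda>_::nat. \<mu>))"
  shows "(\<integral>\<^sup>+x. \<integral>\<^sup>+y. f x y \<partial>PiM I (\<lambda>_. \<mu>) \<partial>\<mu>) = (\<integral>\<^sup>+y. \<integral>\<^sup>+x. f x y \<partial>\<mu> \<partial>PiM I (\<lambda>_. \<mu>))"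
  using pair_sigma_finite.Fubini'[OF pair_sigma_finite_PiM[OF assms(1)] assms(2)] by simp

text \<open>One factor of the power stays an integral over \<open>x\<close>. In each of the other
  \<open>q\<close> factors the variable is replaced by \<open>y j + x\<close>, using invariance, and
  their product becomes one integral over \<open>y\<close>. In this form \<open>t\<close> occurs
  only through \<open>x + t\<close>, in the arguments of \<open>b\<close>.\<close>

lemma nn_correlation_power_pointwise:
  fixes a b :: "'a \<Rightarrow> ennreal"
  assumes [measurable]: "a \<in> borel_measurable borel" "b \<in> borel_measurable borel"
  shows "(\<integral>\<^sup>+x. a x * b (x + t) \<partial>\<mu>) ^ Suc q =
    (\<integral>\<^sup>+x. \<integral>\<^sup>+y. (a x * (\<Prod>j<q. a (y j + x))) * (b (x + t) * (\<Prod>j<q. b (y j + (x + t))))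
      \<partial>PiM {..<q} (\<lambda>_. \<mu>) \<partial>\<mu>)"
proof -
  let ?Y = "PiM {..<q} (\<lambda>_. \<mu>)"
  interpret Y: pair_sigma_finite \<mu> ?Y by (rule pair_sigma_finite_PiM) simp
  have *: "(\<integral>\<^sup>+x. a x * b (x + t) \<partial>\<mu>) ^ q = (\<integral>\<^sup>+y. (\<Prod>j<q. a (y j + x) * b (y j + x + t)) \<partial>?Y)" for x
  proof -
    have "(\<integral>\<^sup>+x. a x * b (x + t) \<partial>\<mu>) ^ q = (\<Prod>j<q. \<integral>\<^sup>+z. a (z + x) * b (z + x + t) \<partial>\<mu>)"
      by (subst nn_integral_translation) simp_all
    also have "\<dots> = (\<integral>\<^sup>+y. (\<Prod>j<q. a (y j + x) * b (y j + x + t)) \<partial>?Y)"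
      by (subst P.product_nn_integral_prod) simp_all
    finally show ?thesis .
  qed
  have "(\<integral>\<^sup>+x. a x * b (x + t) \<partial>\<mu>) ^ Suc q =
    (\<integral>\<^sup>+x. a x * b (x + t) * (\<integral>\<^sup>+y. (\<Prod>j<q. a (y j + x) * b (y j + x + t)) \<partial>?Y) \<partial>\<mu>)"
    by (simp flip: * add: nn_integral_multc)
  also have "\<dots> = (\<integral>\<^sup>+x. \<integral>\<^sup>+y. a x * b (x + t) * (\<Prod>j<q. a (y j + x) * b (y j + x + t)) \<partial>?Y \<partial>\<mu>)"
    by (intro nn_integral_cong nn_integral_cmult[symmetric]) measurable
  also have "\<dots> = (\<integral>\<^sup>+x. \<integral>\<^sup>+y. (a x * (\<Prod>j<q. a (y j + x))) *
      (b (x + t) * (\<Prod>j<q. b (y j + (x + t)))) \<partial>?Y \<partial>\<mu>)"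
    by (simp add: prod.distrib ac_simps)
  finally show ?thesis .
qed

text \<open>Since \<open>t\<close> enters only through \<open>x + t\<close>, moving the integral
  over \<open>t\<close> inside and translating it by \<open>x\<close> separates the factor made of
  \<open>a\<close> from the one made of \<open>b\<close>.\<close>

lemma nn_correlation_power:
  fixes a b :: "'a \<Rightarrow> ennreal"
  assumes [measurable]: "a \<in> borel_measurable borel" "b \<in> borel_measurable borel"
  shows "(\<integral>\<^sup>+t. (\<integral>\<^sup>+x. a x * b (x + t) \<partial>\<mu>) ^ Suc q \<partial>\<mu>) =
    (\<integral>\<^sup>+y. (\<integral>\<^sup>+x. a x * (\<Prod>j<q. a (y j + x)) \<partial>\<mu>) * (\<integral>\<^sup>+x. b x * (\<Prod>j<q. b (y j + x)) \<partial>\<mu>)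
      \<partial>PiM {..<q} (\<lambda>_. \<mu>))"
proof -
  let ?Y = "PiM {..<q} (\<lambda>_. \<mu>)"
  interpret Y: pair_sigma_finite \<mu> ?Y by (rule pair_sigma_finite_PiM) simp
  define \<alpha> where "\<alpha> = (\<lambda>y x. a x * (\<Prod>j<q. a (y j + x)))"
  define \<beta> where "\<beta> = (\<lambda>y x. b x * (\<Prod>j<q. b (y j + x)))"
  have [measurable]: "(\<lambda>(y, x). \<alpha> y x) \<in> borel_measurable (?Y \<Otimes>\<^sub>M borel)"
    "(\<lambda>(y, x). \<beta> y x) \<in> borel_measurable (?Y \<Otimes>\<^sub>M borel)"
    unfolding \<alpha>_def \<beta>_def by measurable
  have "(\<integral>\<^sup>+t. (\<integral>\<^sup>+x. a x * b (x + t) \<partial>\<mu>) ^ Suc q \<partial>\<mu>) =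
      (\<integral>\<^sup>+t. \<integral>\<^sup>+x. \<integral>\<^sup>+y. \<alpha> y x * \<beta> y (x + t) \<partial>?Y \<partial>\<mu> \<partial>\<mu>)"
    unfolding \<alpha>_def \<beta>_def by (simp only: nn_correlation_power_pointwise[OF assms])
  also have "\<dots> = (\<integral>\<^sup>+t. \<integral>\<^sup>+y. \<integral>\<^sup>+x. \<alpha> y x * \<beta> y (x + t) \<partial>\<mu> \<partial>?Y \<partial>\<mu>)"
    by (intro nn_integral_cong nn_integral_commute_PiM) measurable
  also have "\<dots> = (\<integral>\<^sup>+y. \<integral>\<^sup>+t. \<integral>\<^sup>+x. \<alpha> y x * \<beta> y (x + t) \<partial>\<mu> \<partial>\<mu> \<partial>?Y)"
    by (intro nn_integral_commute_PiM) measurable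
  also have "\<dots> = (\<integral>\<^sup>+y. \<integral>\<^sup>+x. \<integral>\<^sup>+t. \<alpha> y x * \<beta> y (x + t) \<partial>\<mu> \<partial>\<mu> \<partial>?Y)"
    by (intro nn_integral_cong pair.Fubini') measurable
  also have "\<dots> = (\<integral>\<^sup>+y. (\<integral>\<^sup>+x. \<alpha> y x \<partial>\<mu>) * (\<integral>\<^sup>+x. \<beta> y x \<partial>\<mu>) \<partial>?Y)"
  proof (intro nn_integral_cong)
    fix y assume [measurable]: "y \<in> space ?Y"
    have "(\<integral>\<^sup>+t. \<alpha> y x * \<beta> y (x + t) \<partial>\<mu>) = \<alpha> y x * (\<integral>\<^sup>+t. \<beta> y t \<partial>\<mu>)" for x
      using nn_integral_translation[of "\<beta> y" x] by (simp add: nn_integral_cmult add.commute)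
    then show "(\<integral>\<^sup>+x. \<integral>\<^sup>+t. \<alpha> y x * \<beta> y (x + t) \<partial>\<mu> \<partial>\<mu>) = (\<integral>\<^sup>+x. \<alpha> y x \<partial>\<mu>) * (\<integral>\<^sup>+x. \<beta> y x \<partial>\<mu>)"
      by (simp add: nn_integral_multc)
  qed
  finally show ?thesis unfolding \<alpha>_def \<beta>_def .
qed

text \<open>By \<open>nn_correlation_power\<close> the integral on the left is an inner product of
  functions of \<open>y\<close>, and the two on the right are the squared L2 norms of these
  functions.\<close>

lemma nn_correlation_Cauchy_Schwarz:
  fixes a b :: "'a \<Rightarrow> ennreal"
  assumes [measurable]: "a \<in> borel_measurable borel" "b \<in> borel_measurable borel"
    and "p > 0"
  shows "(\<integral>\<^sup>+t. (\<integral>\<^sup>+x. a x * b (x + t) \<partial>\<mu>) ^ p \<partial>\<mu>)\<^sup>2 \<le>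
    (\<integral>\<^sup>+t. (\<integral>\<^sup>+x. a x * a (x + t) \<partial>\<mu>) ^ p \<partial>\<mu>) * (\<integral>\<^sup>+t. (\<integral>\<^sup>+x. b x * b (x + t) \<partial>\<mu>) ^ p \<partial>\<mu>)"
proof -
  obtain q where p: "p = Suc q" using \<open>p > 0\<close> gr0_implies_Suc by blast
  show ?thesis
    unfolding p nn_correlation_power[OF assms(1,2)] nn_correlation_power[OF assms(1,1)]
      nn_correlation_power[OF assms(2,2)] power2_eq_square[symmetric]
    by (rule Cauchy_Schwarz_nn_integral) measurable
qed

end

section \<open>Iterated conjugation and the correlation inequality for complex functions\<close>

lemma cnj_funpow: "(cnj ^^ n) z = (if even n then z else cnj z)"
  by (induction n) auto

lemma borel_measurable_cnj [measurable (raw)]: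
  "f \<in> borel_measurable M \<Longrightarrow> (\<lambda>x. cnj (f x)) \<in> borel_measurable M"
  by (rule borel_measurable_continuous_on[OF continuous_on_cnj[OF continuous_on_id]])

lemma borel_measurable_cnj_funpow [measurable (raw)]:
  "f \<in> borel_measurable M \<Longrightarrow> (\<lambda>x. (cnj ^^ n) (f x)) \<in> borel_measurable M"
  by (cases "even n") (simp_all add: cnj_funpow borel_measurable_cnj)

lemma norm_cnj_funpow [simp]: "cmod ((cnj ^^ n) z) = cmod z"
  by (simp add: cnj_funpow)

lemma cnj_funpow_integral: "(cnj ^^ n) (LINT x|M. f x) = (LINT x|M. (cnj ^^ n) (f x))"
  by (simp add: cnj_funpow)

lemma cnj_funpow_mult: "(cnj ^^ n) (z * w) = (cnj ^^ n) z * (cnj ^^ n) w"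
  by (simp add: cnj_funpow)

text \<open>For odd \<open>q\<close> the \<open>Suc q\<close> factors alternate between
  \<open>z\<close> and \<open>cnj z\<close> and pair up into copies of \<open>z * cnj z\<close>.
  This replaces the modulus by an expression that is multiplicative in \<open>z\<close> and
  \<open>cnj z\<close>, so that an even power of the modulus of an integral unfolds into a product
  of integrals.\<close>

lemma norm_power_eq_prod_cnj_funpow:
  assumes "odd q"
  shows "complex_of_real (cmod z ^ Suc q) = z * (\<Prod>j<q. (cnj ^^ Suc j) z)"
proof -
  obtain k where q: "q = Suc (2 * k)" using assms by (auto elim: oddE)
  have "complex_of_real (cmod z ^ Suc (Suc (2 * k))) = z * (\<Prod>j<Suc (2 * k). (cnj ^^ Suc j) z)"
  proof (induction k)
    case 0
    then show ?case using complex_norm_square[of z] by (simp add: power2_eq_square)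
  next
    case (Suc k)
    have "complex_of_real (cmod z ^ Suc (Suc (2 * Suc k))) =
        complex_of_real (cmod z ^ Suc (Suc (2 * k))) * complex_of_real ((cmod z)\<^sup>2)"
      by (simp add: power2_eq_square)
    also have "\<dots> = z * (\<Prod>j<Suc (2 * k). (cnj ^^ Suc j) z) * (z * cnj z)"
      unfolding Suc complex_norm_square ..
    also have "\<dots> = z * (\<Prod>j<Suc (2 * Suc k). (cnj ^^ Suc j) z)"
      by (simp add: cnj_funpow)
    finally show ?case .
  qed
  then show ?thesis unfolding q .
qed

lemma ennreal_prod_norm: "ennreal (\<Prod>i\<in>A. norm (f i)) = (\<Prod>i\<in>A. ennreal (norm (f i)))"
  by (simp add: prod_ennreal)

text \<open>Integrability is not at issue: for a non-integrable \<open>f\<close> the Bochner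
  integral has the default value 0.\<close>

lemma norm_integral_le_nn_integral:
  fixes f :: "'a \<Rightarrow> 'b::{banach, second_countable_topology}"
  shows "ennreal (norm (integral\<^sup>L M f)) \<le> (\<integral>\<^sup>+x. ennreal (norm (f x)) \<partial>M)"
  by (cases "integrable M f") (simp_all add: integral_norm_bound_ennreal not_integrable_integral_eq)

context translation_invariant_measure
begin

text \<open>The complex form of \<open>nn_correlation_power\<close> for the even exponent
  \<open>Suc q\<close>. The same substitution and exchange of integrals are used; they are now
  justified by \<open>fin\<close>, which bounds the integrals with absolute values inside.\<close>

lemma correlation_power:
  fixes a b :: "'a \<Rightarrow> complex"
  assumes [measurable]: "a \<in> borel_measurable borel" "b \<in> borel_measurable borel"
    and fin: "(\<integral>\<^sup>+t. (\<integral>\<^sup>+x. ennreal (cmod (a x)) * ennreal (cmod (b (x + t))) \<partial>\<mu>) ^ Suc q \<partial>\<mu>) < \<infinity>"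
    and q: "odd q"
  defines "P \<equiv> \<lambda>a y. LINT x|\<mu>. cnj (a x) * (\<Prod>j<q. (cnj ^^ j) (a (y j + x)))"
  shows "integrable (PiM {..<q} (\<lambda>_. \<mu>)) (\<lambda>y. P a y * cnj (P b y))"
    and "(LINT t|\<mu>. complex_of_real (cmod (LINT x|\<mu>. cnj (a x) * b (x + t)) ^ Suc q)) =
      (LINT y|PiM {..<q} (\<lambda>_. \<mu>). P a y * cnj (P b y))"
proof -
  let ?Y = "PiM {..<q} (\<lambda>_. \<mu>)"
  interpret Y: sigma_finite_measure ?Y by (rule P.sigma_finite) simp
  interpret XX: sigma_finite_measure "\<mu> \<Otimes>\<^sub>M \<mu>"
    by (rule sigma_finite_pair_measure) unfold_locales
  interpret Y3: pair_sigma_finite ?Y "\<mu> \<Otimes>\<^sub>M \<mu>" ..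
  define \<alpha> where "\<alpha> = (\<lambda>y x. cnj (a x) * (\<Prod>j<q. (cnj ^^ j) (a (y j + x))))"
  \<comment> \<open>The conjugation exponents are one higher than in \<open>\<alpha>\<close>:
    \<open>\<beta>\<close> is the conjugate of the expression \<open>\<alpha>\<close> with
    \<open>b\<close> in place of \<open>a\<close>, which is why its integral is
    \<open>cnj (P b y)\<close>.\<close>
  define \<beta> where "\<beta> = (\<lambda>y x. b x * (\<Prod>j<q. (cnj ^^ Suc j) (b (y j + x))))"
  have [measurable]: "(\<lambda>(y, x). \<alpha> y x) \<in> borel_measurable (?Y \<Otimes>\<^sub>M borel)"
    "(\<lambda>(y, x). \<beta> y x) \<in> borel_measurable (?Y \<Otimes>\<^sub>M borel)"
    unfolding \<alpha>_def \<beta>_def by measurable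
  let ?A = "\<lambda>t. \<integral>\<^sup>+x. ennreal (cmod (a x)) * ennreal (cmod (b (x + t))) \<partial>\<mu>"
  have norm_eq: "ennreal (cmod (\<alpha> y x * \<beta> y z)) = (ennreal (cmod (a x)) * (\<Prod>j<q. ennreal (cmod (a (y j + x))))) *
      (ennreal (cmod (b z)) * (\<Prod>j<q. ennreal (cmod (b (y j + z)))))" for y x z
    unfolding \<alpha>_def \<beta>_def norm_mult prod_norm[symmetric]
    by (simp add: ennreal_mult prod_nonneg ennreal_prod_norm del: funpow.simps)
  \<comment> \<open>All later exchanges of integrals rest on absolute integrability in
    \<open>y\<close>, \<open>t\<close> and \<open>x\<close> jointly. The integral of the modulus is,
    by the nonnegative identity, the quantity that \<open>fin\<close> assumes finite.\<close>
  let ?G = "\<lambda>(y, t, x). \<alpha> y x * \<beta> y (x + t)"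
  have int: "integrable (?Y \<Otimes>\<^sub>M (\<mu> \<Otimes>\<^sub>M \<mu>)) ?G"
  proof (rule integrableI_bounded)
    show "?G \<in> borel_measurable (?Y \<Otimes>\<^sub>M (\<mu> \<Otimes>\<^sub>M \<mu>))" by measurable
    have "(\<integral>\<^sup>+z. ennreal (cmod (?G z)) \<partial>(?Y \<Otimes>\<^sub>M (\<mu> \<Otimes>\<^sub>M \<mu>))) =
       (\<integral>\<^sup>+z. \<integral>\<^sup>+y. ennreal (cmod (?G (y, z))) \<partial>?Y \<partial>(\<mu> \<Otimes>\<^sub>M \<mu>))"
      by (rule Y3.nn_integral_snd[symmetric]) measurable
    also have "\<dots> = (\<integral>\<^sup>+t. \<integral>\<^sup>+x. \<integral>\<^sup>+y. ennreal (cmod (?G (y, t, x))) \<partial>?Y \<partial>\<mu> \<partial>\<mu>)"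
      by (rule nn_integral_fst[symmetric]) measurable
    also have "\<dots> = (\<integral>\<^sup>+t. ?A t ^ Suc q \<partial>\<mu>)"
      unfolding prod.case norm_eq by (subst nn_correlation_power_pointwise) simp_all
    finally show "(\<integral>\<^sup>+z. ennreal (cmod (?G z)) \<partial>(?Y \<Otimes>\<^sub>M (\<mu> \<Otimes>\<^sub>M \<mu>))) < \<infinity>"
      using fin by simp
  qed
  have inner: "(LINT x|\<mu>. LINT t|\<mu>. \<alpha> y x * \<beta> y (x + t)) = P a y * cnj (P b y)"
    if [measurable]: "y \<in> space ?Y" for y
  proof -
    have [measurable]: "\<alpha> y \<in> borel_measurable borel" "\<beta> y \<in> borel_measurable borel" by measurable
    have "(LINT x|\<mu>. LINT t|\<mu>. \<alpha> y x * \<beta> y (x + t)) = (LINT x|\<mu>. \<alpha> y x * (LINT t|\<mu>. \<beta> y t))"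
      using integral_translation[of "\<beta> y"] by (simp add: add.commute)
    also have "\<dots> = P a y * (LINT t|\<mu>. \<beta> y t)"
      by (simp add: P_def \<alpha>_def)
    also have "(LINT t|\<mu>. \<beta> y t) = (LINT t|\<mu>. cnj (cnj (b t) * (\<Prod>j<q. (cnj ^^ j) (b (y j + t)))))"
      unfolding \<beta>_def by simp
    also have "\<dots> = cnj (P b y)"
      unfolding P_def by (rule Bochner_Integration.integral_cnj)
    finally show ?thesis .
  qed
  have ae_y: "AE y in ?Y. (LINT z|(\<mu> \<Otimes>\<^sub>M \<mu>). ?G (y, z)) = P a y * cnj (P b y)"
    using AE_space Y3.AE_integrable_fst'[OF int]
  proof eventually_elim
    case (elim y)
    have "(LINT z|(\<mu> \<Otimes>\<^sub>M \<mu>). ?G (y, z)) = (LINT x|\<mu>. LINT t|\<mu>. \<alpha> y x * \<beta> y (x + t))"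
      using pair.integral_snd[of "\<lambda>t x. \<alpha> y x * \<beta> y (x + t)"] elim(2) by simp
    then show ?case using inner[OF elim(1)] by simp
  qed
  have measY [measurable]: "(\<lambda>y. P a y) \<in> borel_measurable ?Y" "(\<lambda>y. P b y) \<in> borel_measurable ?Y"
    unfolding P_def by measurable
  have "integrable ?Y (\<lambda>y. LINT z|(\<mu> \<Otimes>\<^sub>M \<mu>). ?G (y, z))"
    by (rule Y3.integrable_fst'[OF int])
  then show "integrable ?Y (\<lambda>y. P a y * cnj (P b y))"
    by (rule integrable_cong_AE_imp) (use ae_y in \<open>auto elim: eventually_mono\<close>)
  have int2: "integrable (\<mu> \<Otimes>\<^sub>M \<mu>) (\<lambda>z. LINT y|?Y. ?G (y, z))"
    using Y3.integrable_snd[of "\<lambda>y z. ?G (y, z)"] int by (simp add: case_prod_unfold)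
  have "(LINT y|?Y. P a y * cnj (P b y)) = (LINT y|?Y. LINT z|(\<mu> \<Otimes>\<^sub>M \<mu>). ?G (y, z))"
    by (rule integral_cong_AE) (use ae_y in \<open>auto elim: eventually_mono\<close>)
  also have "\<dots> = integral\<^sup>L (?Y \<Otimes>\<^sub>M (\<mu> \<Otimes>\<^sub>M \<mu>)) ?G"
    by (rule Y3.integral_fst'[OF int])
  also have "\<dots> = (LINT z|(\<mu> \<Otimes>\<^sub>M \<mu>). LINT y|?Y. ?G (y, z))"
    using Y3.integral_snd[of "\<lambda>y z. ?G (y, z)"] int by (simp add: case_prod_unfold)
  also have "\<dots> = (LINT t|\<mu>. LINT x|\<mu>. LINT y|?Y. \<alpha> y x * \<beta> y (x + t))"
    using pair.integral_fst'[OF int2] by simp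
  also have "\<dots> = (LINT t|\<mu>. complex_of_real (cmod (LINT x|\<mu>. cnj (a x) * b (x + t)) ^ Suc q))"
  proof (rule integral_cong_AE)
    \<comment> \<open>For almost every \<open>t\<close> the correlation converges absolutely, so the
      \<open>q\<close> integrals indexed by \<open>j\<close> exist and may be merged into one over
      \<open>y\<close>.\<close>
    have "AE t in \<mu>. ?A t ^ Suc q \<noteq> \<infinity>"
      using fin by (intro nn_integral_PInf_AE) auto
    then show "AE t in \<mu>. (LINT x|\<mu>. LINT y|?Y. \<alpha> y x * \<beta> y (x + t)) =
      complex_of_real (cmod (LINT x|\<mu>. cnj (a x) * b (x + t)) ^ Suc q)"
    proof eventually_elim
      case (elim t)
      let ?c = "LINT x|\<mu>. cnj (a x) * b (x + t)"
      have "?A t < \<infinity>" using elim by (simp add: power_eq_top_ennreal less_top del: power_Suc)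
      then have intA: "integrable \<mu> (\<lambda>z. (cnj ^^ j) (a z) * (cnj ^^ Suc j) (b (z + t)))" for j
        by (intro integrableI_bounded) (simp_all add: norm_mult ennreal_mult del: funpow.simps)
      have "(LINT y|?Y. \<alpha> y x * \<beta> y (x + t)) = cnj (a x) * b (x + t) * (\<Prod>j<q. (cnj ^^ Suc j) ?c)" for x
      proof -
        have "(LINT y|?Y. \<alpha> y x * \<beta> y (x + t)) = cnj (a x) * b (x + t) *
            (LINT y|?Y. (\<Prod>j<q. (cnj ^^ j) (a (y j + x)) * (cnj ^^ Suc j) (b (y j + x + t))))"
          unfolding integral_mult_right_zero[symmetric] \<alpha>_def \<beta>_def
          by (simp add: prod.distrib ac_simps del: funpow.simps)
        also have "(LINT y|?Y. (\<Prod>j<q. (cnj ^^ j) (a (y j + x)) * (cnj ^^ Suc j) (b (y j + x + t)))) =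
          (\<Prod>j<q. (LINT z|\<mu>. (cnj ^^ j) (a (z + x)) * (cnj ^^ Suc j) (b (z + x + t))))"
        proof (rule P.product_integral_prod)
          show "integrable \<mu> (\<lambda>z. (cnj ^^ j) (a (z + x)) * (cnj ^^ Suc j) (b (z + x + t)))" for j
            using intA[of j] by (subst integrable_translation_iff) (simp_all del: funpow.simps)
        qed simp
        also have "\<dots> = (\<Prod>j<q. (LINT z|\<mu>. (cnj ^^ j) (a z) * (cnj ^^ Suc j) (b (z + t))))"
          by (subst integral_translation) (simp_all del: funpow.simps)
        also have "\<dots> = (\<Prod>j<q. (cnj ^^ Suc j) ?c)"
          unfolding cnj_funpow_integral
          by (intro prod.cong refl Bochner_Integration.integral_cong) (simp add: cnj_funpow)
        finally show ?thesis .
      qed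
      then show ?case
        by (subst norm_power_eq_prod_cnj_funpow[OF q]) (simp del: funpow.simps)
    qed
  qed measurable
  finally show "(LINT t|\<mu>. complex_of_real (cmod (LINT x|\<mu>. cnj (a x) * b (x + t)) ^ Suc q)) =
      (LINT y|?Y. P a y * cnj (P b y))" ..
qed

text \<open>By \<open>correlation_power\<close> the mixed integral is the modulus of the inner
  product of \<open>P a\<close> and \<open>P b\<close> over \<open>y\<close>, and the two unmixed
  ones are the squared L2 norms of \<open>P a\<close> and \<open>P b\<close>.\<close>

lemma correlation_Cauchy_Schwarz:
  fixes a b :: "'a \<Rightarrow> complex"
  assumes [measurable]: "a \<in> borel_measurable borel" "b \<in> borel_measurable borel"
    and fin_a: "(\<integral>\<^sup>+t. (\<integral>\<^sup>+x. ennreal (cmod (a x)) * ennreal (cmod (a (x + t))) \<partial>\<mu>) ^ p \<partial>\<mu>) < \<infinity>"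
    and fin_b: "(\<integral>\<^sup>+t. (\<integral>\<^sup>+x. ennreal (cmod (b x)) * ennreal (cmod (b (x + t))) \<partial>\<mu>) ^ p \<partial>\<mu>) < \<infinity>"
    and p: "even p" "p > 0"
  shows "(\<integral>\<^sup>+t. ennreal (cmod (LINT x|\<mu>. cnj (a x) * b (x + t)) ^ p) \<partial>\<mu>)\<^sup>2 \<le>
    (\<integral>\<^sup>+t. ennreal (cmod (LINT x|\<mu>. cnj (a x) * a (x + t)) ^ p) \<partial>\<mu>) *
    (\<integral>\<^sup>+t. ennreal (cmod (LINT x|\<mu>. cnj (b x) * b (x + t)) ^ p) \<partial>\<mu>)"
proof -
  obtain q where q: "p = Suc q" "odd q" using p by (cases p) auto
  let ?Y = "PiM {..<q} (\<lambda>_. \<mu>)"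
  define P where "P = (\<lambda>a y. LINT x|\<mu>. cnj (a x) * (\<Prod>j<q. (cnj ^^ j) (a (y j + x))))"
  let ?n = "\<lambda>a b. \<integral>\<^sup>+t. ennreal (cmod (LINT x|\<mu>. cnj (a x) * b (x + t)) ^ p) \<partial>\<mu>"
  let ?nn = "\<lambda>a b. \<integral>\<^sup>+t. (\<integral>\<^sup>+x. ennreal (cmod (a x)) * ennreal (cmod (b (x + t))) \<partial>\<mu>) ^ p \<partial>\<mu>"
  have measP: "(\<lambda>y. P a y) \<in> borel_measurable ?Y"
    if [measurable]: "a \<in> borel_measurable borel" for a
    unfolding P_def by measurable
  have le: "?n a b \<le> ?nn a b" for a b
  proof (intro nn_integral_mono)
    fix t
    have "ennreal (cmod (LINT x|\<mu>. cnj (a x) * b (x + t))) \<le> (\<integral>\<^sup>+x. ennreal (cmod (cnj (a x) * b (x + t))) \<partial>\<mu>)"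
      by (rule norm_integral_le_nn_integral)
    then show "ennreal (cmod (LINT x|\<mu>. cnj (a x) * b (x + t)) ^ p) \<le>
       (\<integral>\<^sup>+x. ennreal (cmod (a x)) * ennreal (cmod (b (x + t))) \<partial>\<mu>) ^ p"
      by (simp add: norm_mult ennreal_mult power_mono_ennreal flip: ennreal_power)
  qed
  have *: "?n a b = ennreal (cmod (LINT y|?Y. P a y * cnj (P b y)))"
      "integrable ?Y (\<lambda>y. P a y * cnj (P b y))"
    if fin: "?nn a b < \<infinity>" and [measurable]: "a \<in> borel_measurable borel" "b \<in> borel_measurable borel" for a b
  proof -
    let ?f = "\<lambda>t. cmod (LINT x|\<mu>. cnj (a x) * b (x + t)) ^ p"
    show "integrable ?Y (\<lambda>y. P a y * cnj (P b y))"
      using correlation_power(1)[of a b q] fin q unfolding P_def by simp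
    have "?n a b = ennreal (LINT t|\<mu>. ?f t)"
      using fin le[of a b]
      by (intro nn_integral_eq_integral integrableI_bounded) auto
    also have "(LINT t|\<mu>. ?f t) = cmod (LINT t|\<mu>. complex_of_real (?f t))"
      by (simp only: integral_complex_of_real norm_of_real) (simp add: integral_nonneg_AE)
    also have "\<dots> = cmod (LINT y|?Y. P a y * cnj (P b y))"
      using correlation_power(2)[of a b q] fin q unfolding P_def by simp
    finally show "?n a b = ennreal (cmod (LINT y|?Y. P a y * cnj (P b y)))" .
  qed
  have **: "?n a a = (\<integral>\<^sup>+y. (ennreal (cmod (P a y)))\<^sup>2 \<partial>?Y)"
    if fin: "?nn a a < \<infinity>" and [measurable]: "a \<in> borel_measurable borel" for a
  proof -
    have eq: "P a y * cnj (P a y) = complex_of_real ((cmod (P a y))\<^sup>2)" for y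
      by (rule complex_norm_square[symmetric])
    have "?n a a = ennreal (cmod (LINT y|?Y. complex_of_real ((cmod (P a y))\<^sup>2)))"
      using *(1)[OF fin that(2) that(2)] unfolding eq .
    also have "\<dots> = ennreal (LINT y|?Y. (cmod (P a y))\<^sup>2)"
      by (simp only: integral_complex_of_real norm_of_real) (simp add: integral_nonneg_AE)
    also have "\<dots> = (\<integral>\<^sup>+y. ennreal ((cmod (P a y))\<^sup>2) \<partial>?Y)"
      using *(2)[OF fin that(2) that(2)] unfolding eq
      by (intro nn_integral_eq_integral[symmetric]) (simp_all only: complex_of_real_integrable_eq, simp)
    finally show ?thesis by (simp add: ennreal_power)
  qed
  \<comment> \<open>The nonnegative inequality supplies the finiteness of the mixed correlation that
    \<open>correlation_power\<close> requires.\<close>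
  have "?nn a b < \<infinity>"
  proof -
    have "(?nn a b)\<^sup>2 \<le> ?nn a a * ?nn b b"
      by (rule nn_correlation_Cauchy_Schwarz) (use p in auto)
    also have "\<dots> < \<infinity>" using fin_a fin_b by (simp add: ennreal_mult_less_top)
    finally show ?thesis by (simp add: power_less_top_ennreal)
  qed
  then have "?n a b \<le> (\<integral>\<^sup>+y. ennreal (cmod (P a y)) * ennreal (cmod (P b y)) \<partial>?Y)"
    using norm_integral_le_nn_integral[of ?Y "\<lambda>y. P a y * cnj (P b y)"]
    by (simp add: *(1) norm_mult ennreal_mult)
  then have "(?n a b)\<^sup>2 \<le> (\<integral>\<^sup>+y. ennreal (cmod (P a y)) * ennreal (cmod (P b y)) \<partial>?Y)\<^sup>2"
    by (rule power_mono_ennreal)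
  also have "\<dots> \<le> (\<integral>\<^sup>+y. (ennreal (cmod (P a y)))\<^sup>2 \<partial>?Y) * (\<integral>\<^sup>+y. (ennreal (cmod (P b y)))\<^sup>2 \<partial>?Y)"
    using measP[of a] measP[of b] by (intro Cauchy_Schwarz_nn_integral) auto
  also have "\<dots> = ?n a a * ?n b b"
    using fin_a fin_b by (simp add: **)
  finally show ?thesis .
qed

end

section \<open>The Gowers--Cauchy--Schwarz inequality\<close>

text \<open>Cauchy--Schwarz for the square roots of \<open>u\<close> and \<open>v\<close>. It lets
  an inequality known for almost every value of the remaining directions be integrated over them.
  Square roots are taken in the reals, so infinite integrals are treated apart; a vanishing integral
  comes first, because 0 times infinity is 0 and \<open>n\<close> must then vanish almost
  everywhere.\<close>

lemma nn_integral_square_le: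
  fixes n u v :: "'a \<Rightarrow> ennreal"
  assumes [measurable]: "n \<in> borel_measurable M" "u \<in> borel_measurable M" "v \<in> borel_measurable M"
    and le: "AE x in M. (n x)\<^sup>2 \<le> u x * v x"
  shows "(\<integral>\<^sup>+x. n x \<partial>M)\<^sup>2 \<le> (\<integral>\<^sup>+x. u x \<partial>M) * (\<integral>\<^sup>+x. v x \<partial>M)"
proof (cases "(\<integral>\<^sup>+x. u x \<partial>M) = 0 \<or> (\<integral>\<^sup>+x. v x \<partial>M) = 0")
  case True
  then have "(AE x in M. u x = 0) \<or> (AE x in M. v x = 0)"
    by (simp add: nn_integral_0_iff_AE)
  then have "AE x in M. u x * v x = 0"
    by (auto elim: eventually_mono)
  with le have "AE x in M. n x = 0" by eventually_elim simp
  then have "(\<integral>\<^sup>+x. n x \<partial>M) = 0" by (simp add: nn_integral_0_iff_AE)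
  then show ?thesis by simp
next
  case False
  show ?thesis
  proof (cases "(\<integral>\<^sup>+x. u x \<partial>M) = \<infinity> \<or> (\<integral>\<^sup>+x. v x \<partial>M) = \<infinity>")
    case True
    with False show ?thesis by (auto simp: ennreal_mult_eq_top_iff)
  next
    case fin: False
    define s :: "('a \<Rightarrow> ennreal) \<Rightarrow> 'a \<Rightarrow> ennreal" where "s = (\<lambda>w x. ennreal (sqrt (enn2real (w x :: ennreal))))"
    have [measurable]: "s u \<in> borel_measurable M" "s v \<in> borel_measurable M"
      unfolding s_def by measurable
    have sq: "(s w x)\<^sup>2 = w x" if "w x \<noteq> \<infinity>" for w :: "'a \<Rightarrow> ennreal" and x
      using that by (simp add: s_def ennreal_power less_top)
    have ae: "AE x in M. u x \<noteq> \<infinity>" "AE x in M. v x \<noteq> \<infinity>"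
      using nn_integral_PInf_AE[of u M] nn_integral_PInf_AE[of v M] fin by auto
    have "AE x in M. n x \<le> s u x * s v x"
      using le ae
    proof eventually_elim
      case (elim x)
      then obtain a b where ab: "u x = ennreal a" "a \<ge> 0" "v x = ennreal b" "b \<ge> 0"
        by (metis ennreal_cases infinity_ennreal_def)
      have "u x * v x < \<infinity>" using elim(2,3) by (simp add: ennreal_mult_less_top less_top)
      with elim(1) have "(n x)\<^sup>2 < \<infinity>" by (rule le_less_trans)
      then have "n x \<noteq> \<infinity>" by (auto simp: power_less_top_ennreal)
      then obtain c where c: "n x = ennreal c" "c \<ge> 0"
        by (metis ennreal_cases infinity_ennreal_def)
      have "c\<^sup>2 \<le> a * b"
        using elim(1) ab c by (simp add: ennreal_power flip: ennreal_mult)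
      then have "c \<le> sqrt (a * b)" by (rule real_le_rsqrt)
      then show ?case unfolding s_def using ab c
        by (simp add: real_sqrt_mult flip: ennreal_mult)
    qed
    then have "(\<integral>\<^sup>+x. n x \<partial>M) \<le> (\<integral>\<^sup>+x. s u x * s v x \<partial>M)"
      by (rule nn_integral_mono_AE)
    then have "(\<integral>\<^sup>+x. n x \<partial>M)\<^sup>2 \<le> (\<integral>\<^sup>+x. s u x * s v x \<partial>M)\<^sup>2"
      by (rule power_mono_ennreal)
    also have "\<dots> \<le> (\<integral>\<^sup>+x. (s u x)\<^sup>2 \<partial>M) * (\<integral>\<^sup>+x. (s v x)\<^sup>2 \<partial>M)"
      by (rule Cauchy_Schwarz_nn_integral) measurable
    also have "(\<integral>\<^sup>+x. (s u x)\<^sup>2 \<partial>M) = (\<integral>\<^sup>+x. u x \<partial>M)"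
      using ae(1) by (intro nn_integral_cong_AE) (auto simp: sq elim!: eventually_mono)
    also have "(\<integral>\<^sup>+x. (s v x)\<^sup>2 \<partial>M) = (\<integral>\<^sup>+x. v x \<partial>M)"
      using ae(2) by (intro nn_integral_cong_AE) (auto simp: sq elim!: eventually_mono)
    finally show ?thesis .
  qed
qed

section \<open>Cauchy--Schwarz in all directions of the cube\<close>

lemma prod_Pow_insert:
  assumes "finite I" "i \<notin> I"
  shows "(\<Prod>S\<in>Pow (insert i I). g S) = (\<Prod>S\<in>Pow I. g S * g (insert i S))"
proof -
  have "(\<Prod>S\<in>Pow (insert i I). g S) = (\<Prod>S\<in>Pow I. g S) * (\<Prod>S\<in>insert i ` Pow I. g S)"
    unfolding Pow_insert using assms by (intro prod.union_disjoint) auto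
  also have "(\<Prod>S\<in>insert i ` Pow I. g S) = (\<Prod>S\<in>Pow I. g (insert i S))"
  proof -
    have "inj_on (insert i) (Pow I)"
      by (rule inj_onI) (metis assms(2) insert_ident PowD subsetD)
    then show ?thesis by (simp add: prod.reindex)
  qed
  finally show ?thesis by (simp add: prod.distrib)
qed

text \<open>The induction is over the set \<open>J\<close> of directions already treated. In
  \<open>\<lambda>S. F ((S - J) \<union> T)\<close> the coordinates in \<open>J\<close> are frozen
  to those of \<open>T\<close>; treating one more direction squares the left side and splits each
  factor in two. Leaving \<open>N\<close> and \<open>V\<close> abstract covers both the nonnegative
  and the complex functional.\<close>

lemma iterated_Cauchy_Schwarz:
  fixes N :: "(nat set \<Rightarrow> 'f) \<Rightarrow> ennreal"
  assumes step: "\<And>F i. \<lbrakk>\<And>S. F S \<in> V; i < d\<rbrakk> \<Longrightarrow> (N F)\<^sup>2 \<le> N (\<lambda>S. F (S - {i})) * N (\<lambda>S. F (insert i S))"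
    and cong: "\<And>F G. (\<And>S. S \<subseteq> {..<d} \<Longrightarrow> F S = G S) \<Longrightarrow> N F = N G"
    and V: "\<And>S. F S \<in> V"
  shows "N F ^ (2 ^ d) \<le> (\<Prod>T\<in>Pow {..<d}. N (\<lambda>_. F T))"
proof -
  have "N F ^ (2 ^ card J) \<le> (\<Prod>T\<in>Pow J. N (\<lambda>S. F ((S - J) \<union> T)))" if "finite J" "J \<subseteq> {..<d}" for J
    using that
  proof (induction J)
    case empty
    then show ?case by simp
  next
    case (insert i J)
    have "N F ^ (2 ^ card (insert i J)) = (N F ^ (2 ^ card J))\<^sup>2"
      using insert.hyps by (simp add: mult.commute flip: power_mult)
    also have "\<dots> \<le> (\<Prod>T\<in>Pow J. N (\<lambda>S. F ((S - J) \<union> T)))\<^sup>2"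
      using insert by (intro power_mono_ennreal) auto
    also have "\<dots> = (\<Prod>T\<in>Pow J. (N (\<lambda>S. F ((S - J) \<union> T)))\<^sup>2)"
      by (rule prod_power_distrib)
    also have "\<dots> \<le> (\<Prod>T\<in>Pow J. N (\<lambda>S. F ((S - insert i J) \<union> T)) * N (\<lambda>S. F ((S - insert i J) \<union> insert i T)))"
    proof (rule prod_mono_ennreal)
      fix T
      have "(N (\<lambda>S. F ((S - J) \<union> T)))\<^sup>2 \<le> N (\<lambda>S. F (((S - {i}) - J) \<union> T)) * N (\<lambda>S. F ((insert i S - J) \<union> T))"
        by (rule step) (use V insert in auto)
      also have "(\<lambda>S. F (((S - {i}) - J) \<union> T)) = (\<lambda>S. F ((S - insert i J) \<union> T))"
        by (intro ext arg_cong[where f = F]) auto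
      also have "(\<lambda>S. F ((insert i S - J) \<union> T)) = (\<lambda>S. F ((S - insert i J) \<union> insert i T))"
        using insert.hyps by (intro ext arg_cong[where f = F]) auto
      finally show "(N (\<lambda>S. F ((S - J) \<union> T)))\<^sup>2 \<le>
        N (\<lambda>S. F ((S - insert i J) \<union> T)) * N (\<lambda>S. F ((S - insert i J) \<union> insert i T))" .
    qed
    also have "\<dots> = (\<Prod>T\<in>Pow (insert i J). N (\<lambda>S. F ((S - insert i J) \<union> T)))"
      using prod_Pow_insert[OF insert.hyps(1,2), of "\<lambda>T. N (\<lambda>S. F ((S - insert i J) \<union> T))"] by (rule sym)
    finally show ?case .
  qed
  \<comment> \<open>For vertices \<open>S\<close> of the cube \<open>S - {..<d}\<close> is empty, so
    each family is constant on the cube; \<open>cong\<close> takes care of its values at other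
    sets.\<close>
  from this[of "{..<d}"] have "N F ^ (2 ^ d) \<le> (\<Prod>T\<in>Pow {..<d}. N (\<lambda>S. F ((S - {..<d}) \<union> T)))"
    by simp
  also have "\<dots> = (\<Prod>T\<in>Pow {..<d}. N (\<lambda>_. F T))"
    by (intro prod.cong refl cong) (auto intro: arg_cong[where f = F])
  finally show ?thesis .
qed

text \<open>The multilinear version of \<^const>\<open>cube_prod\<close>: one function per vertex of the cube.\<close>

definition cube_family :: "nat \<Rightarrow> (nat set \<Rightarrow> 'a::ab_group_add \<Rightarrow> complex) \<Rightarrow> (nat \<Rightarrow> 'a) \<Rightarrow> 'a \<Rightarrow> complex" where
  "cube_family d F h x = (\<Prod>S\<in>Pow {..<d}. (cnj ^^ (d - card S)) (F S (x + (\<Sum>i\<in>S. h i))))"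

text \<open>Used for sets \<open>I\<close> of \<open>d - 1\<close> directions, which is why the exponent is \<open>d - Suc (card S)\<close>.\<close>

definition facet :: "nat \<Rightarrow> nat set \<Rightarrow> (nat set \<Rightarrow> 'a::ab_group_add \<Rightarrow> complex) \<Rightarrow> (nat \<Rightarrow> 'a) \<Rightarrow> 'a \<Rightarrow> complex" where
  "facet d I F h x = (\<Prod>S\<in>Pow I. (cnj ^^ (d - Suc (card S))) (F S (x + (\<Sum>i\<in>S. h i))))"

lemma cube_family_const: "cube_family d (\<lambda>_. f) = cube_prod d f"
  by (simp add: fun_eq_iff cube_family_def cube_prod_def)

lemma norm_cube_family: "cmod (cube_family d F h x) = (\<Prod>S\<in>Pow {..<d}. cmod (F S (x + (\<Sum>i\<in>S. h i))))"
  by (simp add: cube_family_def flip: prod_norm)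

text \<open>Each vertex without \<open>i\<close> is paired with its neighbour in direction
  \<open>i\<close>, which has one conjugation fewer. For fixed remaining directions the cube
  integral is therefore a correlation, at \<open>t\<close>, of two opposite facets.\<close>

lemma cube_family_split:
  assumes "i < d"
  shows "cube_family d F (h(i := t)) x =
    cnj (facet d ({..<d} - {i}) F h x) * facet d ({..<d} - {i}) (\<lambda>S. F (insert i S)) h (x + t)"
proof -
  let ?I = "{..<d} - {i}"
  have d: "{..<d} = insert i ?I" using assms by auto
  have "cube_family d F (h(i := t)) x = (\<Prod>S\<in>Pow (insert i ?I). (cnj ^^ (d - card S)) (F S (x + (\<Sum>j\<in>S. (h(i := t)) j))))"
    unfolding cube_family_def using d by simp
  also have "\<dots> = (\<Prod>S\<in>Pow ?I. (cnj ^^ (d - card S)) (F S (x + (\<Sum>j\<in>S. (h(i := t)) j))) *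
      (cnj ^^ (d - card (insert i S))) (F (insert i S) (x + (\<Sum>j\<in>insert i S. (h(i := t)) j))))"
    by (rule prod_Pow_insert) auto
  also have "\<dots> = (\<Prod>S\<in>Pow ?I. cnj ((cnj ^^ (d - Suc (card S))) (F S (x + (\<Sum>j\<in>S. h j)))) *
      (cnj ^^ (d - Suc (card S))) (F (insert i S) (x + t + (\<Sum>j\<in>S. h j))))"
  proof (intro prod.cong refl)
    fix S assume S: "S \<in> Pow ?I"
    then have "finite S" "i \<notin> S" by (auto intro: finite_subset)
    \<comment> \<open>A set omitting \<open>i\<close> has fewer than \<open>d\<close> elements, so
      the truncated subtraction is exact and one conjugation can be split off.\<close>
    have "card S \<le> card ?I" using S by (intro card_mono) auto
    then have "card S < d" using assms by simp
    then have "d - card S = Suc (d - Suc (card S))" by simp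
    moreover have "(\<Sum>j\<in>S. (h(i := t)) j) = (\<Sum>j\<in>S. h j)"
      using \<open>i \<notin> S\<close> by (intro sum.cong) auto
    ultimately show "(cnj ^^ (d - card S)) (F S (x + (\<Sum>j\<in>S. (h(i := t)) j))) *
      (cnj ^^ (d - card (insert i S))) (F (insert i S) (x + (\<Sum>j\<in>insert i S. (h(i := t)) j))) =
      cnj ((cnj ^^ (d - Suc (card S))) (F S (x + (\<Sum>j\<in>S. h j)))) *
      (cnj ^^ (d - Suc (card S))) (F (insert i S) (x + t + (\<Sum>j\<in>S. h j)))"
      using \<open>finite S\<close> \<open>i \<notin> S\<close> by (simp add: add.assoc)
  qed
  also have "\<dots> = cnj (facet d ?I F h x) * facet d ?I (\<lambda>S. F (insert i S)) h (x + t)"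
    by (simp add: facet_def prod.distrib cnj_prod)
  finally show ?thesis .
qed

lemma facet_cong: "(\<And>S. S \<subseteq> I \<Longrightarrow> F S = G S) \<Longrightarrow> facet d I F = facet d I G"
  by (simp add: facet_def fun_eq_iff)

lemma borel_measurable_cube_product:
  fixes F :: "nat set \<Rightarrow> 'a::{topological_ab_group_add, second_countable_topology} \<Rightarrow> 'b::{real_normed_field, second_countable_topology}"
  assumes sets[measurable_cong]: "sets M = sets borel" and F: "\<And>S. F S \<in> borel_measurable borel"
  shows "(\<lambda>(h, x). \<Prod>S\<in>Pow I. F S (x + (\<Sum>i\<in>S. h i))) \<in> borel_measurable (PiM I (\<lambda>_. M) \<Otimes>\<^sub>M borel)"
  unfolding case_prod_beta
proof (rule borel_measurable_prod)
  fix S assume "S \<in> Pow I"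
  have "(\<lambda>h. h i) \<in> measurable (PiM I (\<lambda>_. M)) borel" if "i \<in> S" for i
  proof -
    have "(\<lambda>h. h i) \<in> measurable (PiM I (\<lambda>_. M)) M"
      using that \<open>S \<in> Pow I\<close> by (intro measurable_component_singleton) auto
    then show ?thesis using measurable_cong_sets[OF refl sets] by blast
  qed
  then have [measurable]: "(\<lambda>h. \<Sum>i\<in>S. h i) \<in> measurable (PiM I (\<lambda>_. M)) borel"
    by (rule borel_measurable_sum)
  note F[measurable]
  show "(\<lambda>z. F S (snd z + (\<Sum>i\<in>S. fst z i))) \<in> borel_measurable (PiM I (\<lambda>_. M) \<Otimes>\<^sub>M borel)"
    by measurable
qed

context translation_invariant_measure
begin

definition R_family :: "nat \<Rightarrow> (nat set \<Rightarrow> 'a \<Rightarrow> complex) \<Rightarrow> (nat \<Rightarrow> 'a) \<Rightarrow> complex" where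
  "R_family d F h = (LINT x|\<mu>. cube_family d F h x)"

text \<open>For measurable families, finiteness of this value is what makes \<open>R_family\<close>
  a genuine integral instead of the default 0.\<close>

definition R_abs :: "nat \<Rightarrow> (nat set \<Rightarrow> 'a \<Rightarrow> complex) \<Rightarrow> (nat \<Rightarrow> 'a) \<Rightarrow> ennreal" where
  "R_abs d F h = (\<integral>\<^sup>+x. ennreal (cmod (cube_family d F h x)) \<partial>\<mu>)"

text \<open>On constant families this is the power of the norm with exponent
  \<open>2 ^ d * p\<close>. All inequalities are proved at this level, with natural exponents, and
  the root is taken at the very end.\<close>

definition N_family :: "nat \<Rightarrow> nat \<Rightarrow> (nat set \<Rightarrow> 'a \<Rightarrow> complex) \<Rightarrow> ennreal" where
  "N_family d p F = (\<integral>\<^sup>+h. ennreal (cmod (R_family d F h)) ^ p \<partial>prod_measure d \<mu>)"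

definition N_abs :: "nat \<Rightarrow> nat \<Rightarrow> (nat set \<Rightarrow> 'a \<Rightarrow> complex) \<Rightarrow> ennreal" where
  "N_abs d p F = (\<integral>\<^sup>+h. R_abs d F h ^ p \<partial>prod_measure d \<mu>)"

lemma measurable_cube_family:
  assumes "\<And>S. F S \<in> borel_measurable borel"
  shows "(\<lambda>(h, x). cube_family d F h x) \<in> borel_measurable (prod_measure d \<mu> \<Otimes>\<^sub>M borel)"
  unfolding cube_family_def
  by (rule borel_measurable_cube_product[where F = "\<lambda>S x. (cnj ^^ (d - card S)) (F S x)"])
    (use assms sets_eq_borel in simp_all)

lemma measurable_facet:
  assumes "\<And>S. F S \<in> borel_measurable borel"
  shows "(\<lambda>(h, x). facet d I F h x) \<in> borel_measurable (PiM I (\<lambda>_. \<mu>) \<Otimes>\<^sub>M borel)"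
  unfolding facet_def
  by (rule borel_measurable_cube_product[where F = "\<lambda>S x. (cnj ^^ (d - Suc (card S))) (F S x)"])
    (use assms sets_eq_borel in simp_all)

lemma measurable_R:
  assumes "\<And>S. F S \<in> borel_measurable borel"
  shows "R_family d F \<in> borel_measurable (prod_measure d \<mu>)"
    and "R_abs d F \<in> borel_measurable (prod_measure d \<mu>)"
proof -
  note [measurable] = measurable_cube_family[OF assms]
  show "R_family d F \<in> borel_measurable (prod_measure d \<mu>)"
    "R_abs d F \<in> borel_measurable (prod_measure d \<mu>)"
    unfolding R_family_def[abs_def] R_abs_def[abs_def] by measurable
qed

lemma nn_integral_prod_measure_split:
  assumes "i < d" "f \<in> borel_measurable (prod_measure d \<mu>)"
  shows "(\<integral>\<^sup>+h. f h \<partial>prod_measure d \<mu>) =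
    (\<integral>\<^sup>+h. \<integral>\<^sup>+t. f (h(i := t)) \<partial>\<mu> \<partial>PiM ({..<d} - {i}) (\<lambda>_. \<mu>))"
proof -
  have "{..<d} = insert i ({..<d} - {i})" using assms by auto
  then show ?thesis
    using P.product_nn_integral_insert[of "{..<d} - {i}" i f] assms(2) by simp
qed

text \<open>Isolating the variable \<open>h i\<close> as \<open>t\<close> leaves, for each choice of
  the other directions, the integrated power of a correlation of two facets, to which the
  one-dimensional inequality applies.\<close>

lemma N_abs_split:
  assumes "i < d" "\<And>S. F S \<in> borel_measurable borel"
  shows "N_abs d p F = (\<integral>\<^sup>+h. \<integral>\<^sup>+t. (\<integral>\<^sup>+x. ennreal (cmod (facet d ({..<d} - {i}) F h x)) *
      ennreal (cmod (facet d ({..<d} - {i}) (\<lambda>S. F (insert i S)) h (x + t))) \<partial>\<mu>) ^ p \<partial>\<mu>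
      \<partial>PiM ({..<d} - {i}) (\<lambda>_. \<mu>))"
proof -
  note [measurable] = measurable_R(2)[where F = F, OF assms(2)]
  show ?thesis
    unfolding N_abs_def
    by (subst nn_integral_prod_measure_split[OF assms(1)], measurable)
      (simp add: R_abs_def cube_family_split[OF assms(1)] norm_mult ennreal_mult)
qed

lemma N_family_split:
  assumes "i < d" "\<And>S. F S \<in> borel_measurable borel"
  shows "N_family d p F = (\<integral>\<^sup>+h. \<integral>\<^sup>+t. ennreal (cmod (LINT x|\<mu>. cnj (facet d ({..<d} - {i}) F h x) *
      facet d ({..<d} - {i}) (\<lambda>S. F (insert i S)) h (x + t)) ^ p) \<partial>\<mu>
      \<partial>PiM ({..<d} - {i}) (\<lambda>_. \<mu>))"
proof -
  note [measurable] = measurable_R(1)[where F = F, OF assms(2)]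
  show ?thesis
    unfolding N_family_def
    by (subst nn_integral_prod_measure_split[OF assms(1)], measurable)
      (simp add: R_family_def cube_family_split[OF assms(1)] ennreal_power)
qed

text \<open>Passing from \<open>F\<close> to \<open>\<lambda>S. F (S - {i})\<close> copies the facet
  without \<open>i\<close> onto the opposite one and leaves it unchanged itself, so the correlation
  becomes an autocorrelation.\<close>

lemma facet_remove: "facet d ({..<d} - {i}) (\<lambda>S. F (S - {i})) = facet d ({..<d} - {i}) F"
  by (intro facet_cong arg_cong[where f = F]) auto

text \<open>The correlation inequality is applied to the two facets for fixed directions other than
  \<open>i\<close>, and then integrated over these with
  \<open>nn_integral_square_le\<close>.\<close>

lemma N_abs_Cauchy_Schwarz:
  assumes "i < d" "\<And>S. F S \<in> borel_measurable borel" "p > 0"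
  shows "(N_abs d p F)\<^sup>2 \<le> N_abs d p (\<lambda>S. F (S - {i})) * N_abs d p (\<lambda>S. F (insert i S))"
proof -
  let ?I = "{..<d} - {i}"
  have [measurable]: "(\<lambda>(h, x). facet d ?I F h x) \<in> borel_measurable (PiM ?I (\<lambda>_. \<mu>) \<Otimes>\<^sub>M borel)"
    "(\<lambda>(h, x). facet d ?I (\<lambda>S. F (insert i S)) h x) \<in> borel_measurable (PiM ?I (\<lambda>_. \<mu>) \<Otimes>\<^sub>M borel)"
    using assms(2) by (intro measurable_facet; simp)+
  have *: "N_abs d p (\<lambda>S. F (S - {i})) = (\<integral>\<^sup>+h. \<integral>\<^sup>+t. (\<integral>\<^sup>+x. ennreal (cmod (facet d ?I F h x)) *
      ennreal (cmod (facet d ?I F h (x + t))) \<partial>\<mu>) ^ p \<partial>\<mu> \<partial>PiM ?I (\<lambda>_. \<mu>))"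
    using assms(2) by (subst N_abs_split[OF assms(1)]) (simp_all add: facet_remove)
  have **: "N_abs d p (\<lambda>S. F (insert i S)) = (\<integral>\<^sup>+h. \<integral>\<^sup>+t. (\<integral>\<^sup>+x. ennreal (cmod (facet d ?I (\<lambda>S. F (insert i S)) h x)) *
      ennreal (cmod (facet d ?I (\<lambda>S. F (insert i S)) h (x + t))) \<partial>\<mu>) ^ p \<partial>\<mu> \<partial>PiM ?I (\<lambda>_. \<mu>))"
    using assms(2) by (subst N_abs_split[OF assms(1)]) simp_all
  show ?thesis
    unfolding * ** N_abs_split[where F = F, OF assms(1,2)]
  proof (rule nn_integral_square_le)
    show "AE h in PiM ?I (\<lambda>_. \<mu>). (\<integral>\<^sup>+t. (\<integral>\<^sup>+x. ennreal (cmod (facet d ?I F h x)) *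
        ennreal (cmod (facet d ?I (\<lambda>S. F (insert i S)) h (x + t))) \<partial>\<mu>) ^ p \<partial>\<mu>)\<^sup>2 \<le>
      (\<integral>\<^sup>+t. (\<integral>\<^sup>+x. ennreal (cmod (facet d ?I F h x)) * ennreal (cmod (facet d ?I F h (x + t))) \<partial>\<mu>) ^ p \<partial>\<mu>) *
      (\<integral>\<^sup>+t. (\<integral>\<^sup>+x. ennreal (cmod (facet d ?I (\<lambda>S. F (insert i S)) h x)) *
        ennreal (cmod (facet d ?I (\<lambda>S. F (insert i S)) h (x + t))) \<partial>\<mu>) ^ p \<partial>\<mu>)" (is "AE h in _. ?le h")
    proof (rule AE_I2)
      fix h assume [measurable]: "h \<in> space (PiM ?I (\<lambda>_. \<mu>))"
      have "(\<lambda>x. ennreal (cmod (facet d ?I F h x))) \<in> borel_measurable borel"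
        "(\<lambda>x. ennreal (cmod (facet d ?I (\<lambda>S. F (insert i S)) h x))) \<in> borel_measurable borel"
        by measurable
      from nn_correlation_Cauchy_Schwarz[OF this \<open>p > 0\<close>]
      show "?le h" .
    qed
  qed measurable
qed

text \<open>As for \<open>N_abs\<close>, but the complex correlation inequality needs finite
  absolute autocorrelations of both facets; by \<open>fin\<close> these are finite for almost every
  choice of the other directions.\<close>

lemma N_family_Cauchy_Schwarz:
  assumes "i < d" "\<And>S. F S \<in> borel_measurable borel" "p > 0" "even p"
    and fin: "N_abs d p (\<lambda>S. F (S - {i})) < \<infinity>" "N_abs d p (\<lambda>S. F (insert i S)) < \<infinity>"
  shows "(N_family d p F)\<^sup>2 \<le> N_family d p (\<lambda>S. F (S - {i})) * N_family d p (\<lambda>S. F (insert i S))"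
proof -
  let ?I = "{..<d} - {i}"
  have [measurable]: "(\<lambda>(h, x). facet d ?I F h x) \<in> borel_measurable (PiM ?I (\<lambda>_. \<mu>) \<Otimes>\<^sub>M borel)"
    "(\<lambda>(h, x). facet d ?I (\<lambda>S. F (insert i S)) h x) \<in> borel_measurable (PiM ?I (\<lambda>_. \<mu>) \<Otimes>\<^sub>M borel)"
    using assms(2) by (intro measurable_facet; simp)+
  have *: "N_abs d p (\<lambda>S. F (S - {i})) = (\<integral>\<^sup>+h. \<integral>\<^sup>+t. (\<integral>\<^sup>+x. ennreal (cmod (facet d ?I F h x)) *
      ennreal (cmod (facet d ?I F h (x + t))) \<partial>\<mu>) ^ p \<partial>\<mu> \<partial>PiM ?I (\<lambda>_. \<mu>))"
    using assms(2) by (subst N_abs_split[OF assms(1)]) (simp_all add: facet_remove)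
  have **: "N_abs d p (\<lambda>S. F (insert i S)) = (\<integral>\<^sup>+h. \<integral>\<^sup>+t. (\<integral>\<^sup>+x. ennreal (cmod (facet d ?I (\<lambda>S. F (insert i S)) h x)) *
      ennreal (cmod (facet d ?I (\<lambda>S. F (insert i S)) h (x + t))) \<partial>\<mu>) ^ p \<partial>\<mu> \<partial>PiM ?I (\<lambda>_. \<mu>))"
    using assms(2) by (subst N_abs_split[OF assms(1)]) simp_all
  have ae: "AE h in PiM ?I (\<lambda>_. \<mu>). (\<integral>\<^sup>+t. (\<integral>\<^sup>+x. ennreal (cmod (facet d ?I F h x)) *
      ennreal (cmod (facet d ?I F h (x + t))) \<partial>\<mu>) ^ p \<partial>\<mu>) \<noteq> \<infinity>"
    using fin(1) unfolding * by (intro nn_integral_PInf_AE) auto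
  have ae': "AE h in PiM ?I (\<lambda>_. \<mu>). (\<integral>\<^sup>+t. (\<integral>\<^sup>+x. ennreal (cmod (facet d ?I (\<lambda>S. F (insert i S)) h x)) *
      ennreal (cmod (facet d ?I (\<lambda>S. F (insert i S)) h (x + t))) \<partial>\<mu>) ^ p \<partial>\<mu>) \<noteq> \<infinity>"
    using fin(2) unfolding ** by (intro nn_integral_PInf_AE) auto
  have *: "N_family d p (\<lambda>S. F (S - {i})) = (\<integral>\<^sup>+h. \<integral>\<^sup>+t. ennreal (cmod (LINT x|\<mu>. cnj (facet d ?I F h x) *
      facet d ?I F h (x + t)) ^ p) \<partial>\<mu> \<partial>PiM ?I (\<lambda>_. \<mu>))"
    using assms(2) by (subst N_family_split[OF assms(1)]) (simp_all add: facet_remove)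
  have **: "N_family d p (\<lambda>S. F (insert i S)) = (\<integral>\<^sup>+h. \<integral>\<^sup>+t. ennreal (cmod (LINT x|\<mu>.
      cnj (facet d ?I (\<lambda>S. F (insert i S)) h x) * facet d ?I (\<lambda>S. F (insert i S)) h (x + t)) ^ p) \<partial>\<mu> \<partial>PiM ?I (\<lambda>_. \<mu>))"
    using assms(2) by (subst N_family_split[OF assms(1)]) simp_all
  show ?thesis
    unfolding * ** N_family_split[where F = F, OF assms(1,2)]
  proof (rule nn_integral_square_le)
    show "AE h in PiM ?I (\<lambda>_. \<mu>). (\<integral>\<^sup>+t. ennreal (cmod (LINT x|\<mu>. cnj (facet d ?I F h x) *
        facet d ?I (\<lambda>S. F (insert i S)) h (x + t)) ^ p) \<partial>\<mu>)\<^sup>2 \<le>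
      (\<integral>\<^sup>+t. ennreal (cmod (LINT x|\<mu>. cnj (facet d ?I F h x) * facet d ?I F h (x + t)) ^ p) \<partial>\<mu>) *
      (\<integral>\<^sup>+t. ennreal (cmod (LINT x|\<mu>. cnj (facet d ?I (\<lambda>S. F (insert i S)) h x) *
        facet d ?I (\<lambda>S. F (insert i S)) h (x + t)) ^ p) \<partial>\<mu>)"
      using ae ae' AE_space
    proof eventually_elim
      case (elim h)
      note elim(3)[measurable]
      have "facet d ?I F h \<in> borel_measurable borel"
        "facet d ?I (\<lambda>S. F (insert i S)) h \<in> borel_measurable borel"
        by measurable
      then show ?case
        using elim(1,2) assms(3,4) by (intro correlation_Cauchy_Schwarz) (auto simp: less_top)
    qed
  qed measurable
qed

lemma cube_family_cong: "(\<And>S. S \<subseteq> {..<d} \<Longrightarrow> F S = G S) \<Longrightarrow> cube_family d F = cube_family d G"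
  by (simp add: cube_family_def fun_eq_iff)

lemma N_abs_cong: "(\<And>S. S \<subseteq> {..<d} \<Longrightarrow> F S = G S) \<Longrightarrow> N_abs d p F = N_abs d p G"
  using cube_family_cong[of d F G] by (simp add: N_abs_def R_abs_def)

lemma N_family_cong: "(\<And>S. S \<subseteq> {..<d} \<Longrightarrow> F S = G S) \<Longrightarrow> N_family d p F = N_family d p G"
  using cube_family_cong[of d F G] by (simp add: N_family_def R_family_def)

lemma N_abs_Gowers_Cauchy_Schwarz:
  assumes "\<And>S. F S \<in> borel_measurable borel" "p > 0"
  shows "N_abs d p F ^ (2 ^ d) \<le> (\<Prod>T\<in>Pow {..<d}. N_abs d p (\<lambda>_. F T))"
proof (rule iterated_Cauchy_Schwarz[where V = "borel_measurable borel"])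
  fix F :: "nat set \<Rightarrow> 'a \<Rightarrow> complex" and i
  assume F: "\<And>S. F S \<in> borel_measurable borel" and i: "i < d"
  show "(N_abs d p F)\<^sup>2 \<le> N_abs d p (\<lambda>S. F (S - {i})) * N_abs d p (\<lambda>S. F (insert i S))"
    by (rule N_abs_Cauchy_Schwarz[OF i F \<open>p > 0\<close>])
qed (fact N_abs_cong assms(1))+

text \<open>The Gowers--Cauchy--Schwarz inequality carries finiteness from the single functions to
  every mixed family, and so makes the complex multilinear integrals meaningful.\<close>

lemma N_abs_family_finite:
  assumes F: "\<And>S. F S \<in> borel_measurable borel" "\<And>S. N_abs d p (\<lambda>_. F S) < \<infinity>" and p: "p > 0"
  shows "N_abs d p F < \<infinity>"
proof -
  have "N_abs d p F ^ (2 ^ d) \<le> (\<Prod>T\<in>Pow {..<d}. N_abs d p (\<lambda>_. F T))"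
    by (rule N_abs_Gowers_Cauchy_Schwarz[OF F(1) p])
  also have "\<dots> < \<infinity>"
    using F(2) by (simp add: less_top[symmetric] ennreal_prod_eq_top)
  finally show ?thesis by (simp add: power_less_top_ennreal)
qed

lemma N_family_Gowers_Cauchy_Schwarz:
  assumes "\<And>S. F S \<in> borel_measurable borel" "\<And>S. N_abs d p (\<lambda>_. F S) < \<infinity>" "p > 0" "even p"
  shows "N_family d p F ^ (2 ^ d) \<le> (\<Prod>T\<in>Pow {..<d}. N_family d p (\<lambda>_. F T))"
\<comment> \<open>\<open>V\<close> carries the finiteness condition through the iteration: the
  families arising in it have the same members, so \<open>N_abs_family_finite\<close> applies to
  them at every step.\<close>
proof (rule iterated_Cauchy_Schwarz[where V = "{f \<in> borel_measurable borel. N_abs d p (\<lambda>_. f) < \<infinity>}"])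
  fix F :: "nat set \<Rightarrow> 'a \<Rightarrow> complex" and i
  assume F: "\<And>S. F S \<in> {f \<in> borel_measurable borel. N_abs d p (\<lambda>_. f) < \<infinity>}" and i: "i < d"
  have F': "F S \<in> borel_measurable borel" "N_abs d p (\<lambda>_. F S) < \<infinity>" for S
    using F[of S] by auto
  show "(N_family d p F)\<^sup>2 \<le> N_family d p (\<lambda>S. F (S - {i})) * N_family d p (\<lambda>S. F (insert i S))"
    by (rule N_family_Cauchy_Schwarz[OF i F'(1) assms(3,4)]; rule N_abs_family_finite)
      (rule F' \<open>p > 0\<close>)+
next
  show "F S \<in> {f \<in> borel_measurable borel. N_abs d p (\<lambda>_. f) < \<infinity>}" for S
    using assms(1,2)[of S] by simp
qed (fact N_family_cong)

end

section \<open>The triangle inequality\<close>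

lemma convex_on_power_nonneg: "convex_on {0..} (\<lambda>x::real. x ^ p)"
  by (cases "even p") (auto intro: convex_power_odd convex_on_subset[OF convex_power_even])

text \<open>Jensen's inequality for \<open>x ^ p\<close> at the points \<open>r i / c i\<close> with
  weights \<open>c i / C\<close>. If each \<open>r i ^ p\<close> integrates to at most
  \<open>c i ^ p\<close>, the right side integrates to at most \<open>C ^ p\<close>, which is
  Minkowski's inequality.\<close>

lemma sum_power_le_weighted:
  fixes r :: "'i \<Rightarrow> ennreal" and c :: "'i \<Rightarrow> real"
  assumes "finite I" "I \<noteq> {}" "\<And>i. i \<in> I \<Longrightarrow> c i > 0" "p > 0"
  defines "C \<equiv> \<Sum>i\<in>I. c i"
  shows "(\<Sum>i\<in>I. r i) ^ p \<le> (\<Sum>i\<in>I. ennreal (C ^ p * (c i / C) / c i ^ p) * r i ^ p)"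
proof -
  have C: "C > 0" unfolding C_def using assms by (intro sum_pos) auto
  show ?thesis
  proof (cases "\<exists>i\<in>I. r i = \<infinity>")
    case True
    then obtain i where i: "i \<in> I" "r i = \<infinity>" by blast
    have "C ^ p * (c i / C) / c i ^ p > 0" using C assms(3)[OF i(1)] by simp
    then have "ennreal (C ^ p * (c i / C) / c i ^ p) * r i ^ p = \<infinity>"
      using i \<open>p > 0\<close> by (simp add: ennreal_mult_top ennreal_eq_0_iff not_le)
    moreover have "ennreal (C ^ p * (c i / C) / c i ^ p) * r i ^ p \<le>
        (\<Sum>i\<in>I. ennreal (C ^ p * (c i / C) / c i ^ p) * r i ^ p)"
      using assms(1) i(1) by (intro member_le_sum) auto
    ultimately show ?thesis by (simp add: top_unique)
  next
    case False
    define s where "s = (\<lambda>i. enn2real (r i))"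
    have r: "r i = ennreal (s i)" if "i \<in> I" for i
      using False that by (simp add: s_def less_top)
    have s: "s i \<ge> 0" for i by (simp add: s_def)
    have nonneg: "C \<ge> 0" "\<And>i. i \<in> I \<Longrightarrow> c i \<ge> 0" using C assms(3) by (auto intro: less_imp_le)
    have "(\<Sum>i\<in>I. s i) = C * (\<Sum>i\<in>I. (c i / C) * (s i / c i))"
      unfolding sum_distrib_left
    proof (intro sum.cong refl)
      fix i assume "i \<in> I"
      then have "c i > 0" by (rule assms(3))
      then show "s i = C * (c i / C * (s i / c i))" using C by simp
    qed
    then have "(\<Sum>i\<in>I. s i) ^ p = C ^ p * (\<Sum>i\<in>I. (c i / C) *\<^sub>R (s i / c i)) ^ p"
      by (simp add: power_mult_distrib)
    also have "\<dots> \<le> C ^ p * (\<Sum>i\<in>I. (c i / C) * (s i / c i) ^ p)"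
    proof (intro mult_left_mono convex_on_sum[OF assms(1,2) convex_on_power_nonneg])
      show "(\<Sum>i\<in>I. c i / C) = 1" using C by (simp add: C_def flip: sum_divide_distrib)
    qed (use s nonneg in auto)
    also have "\<dots> = (\<Sum>i\<in>I. C ^ p * (c i / C) / c i ^ p * s i ^ p)"
      unfolding sum_distrib_left by (simp add: power_divide mult.assoc)
    finally have "ennreal ((\<Sum>i\<in>I. s i) ^ p) \<le> ennreal (\<Sum>i\<in>I. C ^ p * (c i / C) / c i ^ p * s i ^ p)"
      by (rule ennreal_leI)
    also have "\<dots> = (\<Sum>i\<in>I. ennreal (C ^ p * (c i / C) / c i ^ p) * r i ^ p)"
      using s nonneg by (subst sum_ennreal[symmetric])
        (auto intro!: sum.cong simp: r ennreal_power simp flip: ennreal_mult)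
    finally show ?thesis
      using s by (simp add: r sum_ennreal sum_nonneg ennreal_power)
  qed
qed

lemma power_le_imp_le_ennreal:
  fixes x y :: ennreal
  assumes "x ^ n \<le> y ^ n" "n > 0"
  shows "x \<le> y"
proof (cases "y = \<infinity>")
  case False
  then have "y ^ n < \<infinity>" by (simp add: power_less_top_ennreal less_top)
  then have "x ^ n < \<infinity>" using assms(1) by (rule le_less_trans[rotated])
  then have "x \<noteq> \<infinity>" using assms(2) by (auto simp: power_less_top_ennreal)
  then obtain a b where ab: "x = ennreal a" "a \<ge> 0" "y = ennreal b" "b \<ge> 0"
    using False by (metis ennreal_cases infinity_ennreal_def)
  then have "a ^ n \<le> b ^ n" using assms(1) by (simp add: ennreal_power)
  then have "a \<le> b" using ab(4) assms(2) by (simp add: power_mono_iff ab)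
  then show ?thesis using ab by (simp add: ennreal_leI)
qed simp

lemma prod_add_if:
  fixes f g :: "'i \<Rightarrow> 'b::comm_semiring_1"
  assumes "finite A"
  shows "(\<Prod>x\<in>A. f x + g x) = (\<Sum>X\<in>Pow A. \<Prod>x\<in>A. if x \<in> X then f x else g x)"
  unfolding prod_add[OF assms]
proof (intro sum.cong refl)
  fix X assume "X \<in> Pow A"
  then show "(\<Prod>x\<in>X. f x) * (\<Prod>x\<in>A - X. g x) = (\<Prod>x\<in>A. if x \<in> X then f x else g x)"
    using assms by (subst prod.If_cases) (auto simp: Int_absorb1 Diff_eq)
qed

text \<open>
  A Gowers--Cauchy--Schwarz inequality for the multilinear forms \<open>\<integral>r\<^sup>p\<close> together with multilinearity
  of \<open>r\<close> gives the triangle inequality for the \<open>2\<^sup>d p\<close>-th root; Minkowski's inequality enters through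
  the convexity of \<open>x\<^sup>p\<close>.
\<close>

lemma Gowers_triangle:
  fixes r :: "(nat set \<Rightarrow> 'f) \<Rightarrow> 'h \<Rightarrow> ennreal" and M :: "'h measure" and a b :: real
    and d p :: nat and e f g :: 'f
  defines "N \<equiv> \<lambda>F. \<integral>\<^sup>+h. r F h ^ p \<partial>M"
  defines "mix \<equiv> \<lambda>X S. if S \<in> X then f else g"
  assumes GCS: "\<And>X. N (mix X) ^ (2 ^ d) \<le> (\<Prod>T\<in>Pow {..<d}. N (\<lambda>_. mix X T))"
    and meas [measurable]: "\<And>X. r (mix X) \<in> borel_measurable M"
    and expand: "AE h in M. r (\<lambda>_. e) h \<le> (\<Sum>X\<in>Pow (Pow {..<d}). r (mix X) h)"
    and ab: "a > 0" "b > 0" and p: "p > 0"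
    and Nf: "N (\<lambda>_. f) \<le> ennreal (a ^ (2 ^ d * p))" and Ng: "N (\<lambda>_. g) \<le> ennreal (b ^ (2 ^ d * p))"
  shows "N (\<lambda>_. e) \<le> ennreal ((a + b) ^ (2 ^ d * p))"
proof -
  define Q where "Q = Pow {..<d}"
  have Q: "finite Q" "card Q = 2 ^ d" by (auto simp: Q_def card_Pow)
  \<comment> \<open>The size expected of \<open>mix X\<close> when \<open>f\<close> has size
    \<open>a\<close> and \<open>g\<close> has size \<open>b\<close>: one factor per vertex.
    Expanding the product of \<open>a + b\<close> over all vertices shows that these sizes sum to
    \<open>(a + b) ^ (2 ^ d)\<close>.\<close>
  define c where "c X = (\<Prod>T\<in>Q. if T \<in> X then a else b)" for X
  have c: "c X > 0" for X using ab by (auto simp: c_def intro!: prod_pos)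
  define C where "C = (\<Sum>X\<in>Pow Q. c X)"
  have C: "C = (a + b) ^ (2 ^ d)"
    using prod_add_if[OF Q(1), of "\<lambda>_. a" "\<lambda>_. b"] Q(2) by (simp add: C_def c_def)
  have "C > 0" using ab by (simp add: C)
  have N_le: "N (mix X) \<le> ennreal (c X ^ p)" for X
  proof (rule power_le_imp_le_ennreal)
    have "N (mix X) ^ (2 ^ d) \<le> (\<Prod>T\<in>Q. N (\<lambda>_. mix X T))"
      unfolding Q_def by (rule GCS)
    also have "\<dots> \<le> (\<Prod>T\<in>Q. ennreal ((if T \<in> X then a else b) ^ (2 ^ d * p)))"
      using Nf Ng by (intro prod_mono_ennreal) (auto simp: mix_def)
    also have "\<dots> = ennreal (\<Prod>T\<in>Q. (if T \<in> X then a else b) ^ (2 ^ d * p))"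
      using ab by (intro prod_ennreal) auto
    also have "(\<Prod>T\<in>Q. (if T \<in> X then a else b) ^ (2 ^ d * p)) = (c X ^ p) ^ (2 ^ d)"
      unfolding c_def by (simp add: mult.commute flip: prod_power_distrib power_mult)
    also have "ennreal \<dots> = ennreal (c X ^ p) ^ (2 ^ d)"
      using c[of X] by (simp add: ennreal_power)
    finally show "N (mix X) ^ (2 ^ d) \<le> ennreal (c X ^ p) ^ (2 ^ d)" .
  qed simp
  have "N (\<lambda>_. e) \<le> (\<integral>\<^sup>+h. (\<Sum>X\<in>Pow Q. r (mix X) h) ^ p \<partial>M)"
    unfolding N_def using expand
    by (intro nn_integral_mono_AE) (auto elim!: eventually_mono intro: power_mono_ennreal simp: Q_def)
  \<comment> \<open>With weights proportional to \<open>c X\<close>, the bound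
    \<open>c X ^ p\<close> on \<open>N (mix X)\<close> cancels the denominator, and the sum is
    exactly \<open>C ^ p\<close>.\<close>
  also have "\<dots> \<le> (\<integral>\<^sup>+h. (\<Sum>X\<in>Pow Q. ennreal (C ^ p * (c X / C) / c X ^ p) * r (mix X) h ^ p) \<partial>M)"
    unfolding C_def using Q(1) c p by (intro nn_integral_mono sum_power_le_weighted) auto
  also have "\<dots> = (\<Sum>X\<in>Pow Q. ennreal (C ^ p * (c X / C) / c X ^ p) * N (mix X))"
    unfolding N_def by (simp add: nn_integral_sum nn_integral_cmult)
  also have "\<dots> \<le> (\<Sum>X\<in>Pow Q. ennreal (C ^ p * (c X / C) / c X ^ p) * ennreal (c X ^ p))"
    by (intro sum_mono mult_left_mono N_le) auto
  also have "\<dots> = (\<Sum>X\<in>Pow Q. ennreal (C ^ p * (c X / C)))"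
  proof (intro sum.cong refl)
    fix X
    have "c X \<noteq> 0" using c[of X] by simp
    then show "ennreal (C ^ p * (c X / C) / c X ^ p) * ennreal (c X ^ p) = ennreal (C ^ p * (c X / C))"
      using c[of X] \<open>C > 0\<close> by (subst ennreal_mult[symmetric]) (auto simp: less_imp_le)
  qed
  also have "\<dots> = ennreal (\<Sum>X\<in>Pow Q. C ^ p * (c X / C))"
    using c \<open>C > 0\<close> by (intro sum_ennreal) (auto simp: less_imp_le)
  also have "(\<Sum>X\<in>Pow Q. C ^ p * (c X / C)) = C ^ p"
    using \<open>C > 0\<close> by (simp add: C_def flip: sum_distrib_left sum_divide_distrib)
  also have "C ^ p = (a + b) ^ (2 ^ d * p)" by (simp add: C power_mult)
  finally show ?thesis .
qed

context translation_invariant_measure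
begin

lemma R_abs_add_le:
  assumes [measurable]: "f \<in> borel_measurable borel" "g \<in> borel_measurable borel"
    and [measurable]: "h \<in> space (prod_measure d \<mu>)"
  shows "R_abs d (\<lambda>_ x. f x + g x) h \<le> (\<Sum>X\<in>Pow (Pow {..<d}). R_abs d (\<lambda>S. if S \<in> X then f else g) h)"
proof -
  have [measurable]: "(\<lambda>(h, x). cube_family d (\<lambda>S. if S \<in> X then f else g) h x)
      \<in> borel_measurable (prod_measure d \<mu> \<Otimes>\<^sub>M borel)" for X
    by (rule measurable_cube_family) simp
  have "cmod (cube_family d (\<lambda>_ x. f x + g x) h x) \<le>
      (\<Sum>X\<in>Pow (Pow {..<d}). cmod (cube_family d (\<lambda>S. if S \<in> X then f else g) h x))" for x
  proof -
    have "cmod (cube_family d (\<lambda>_ x. f x + g x) h x) \<le>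
      (\<Prod>S\<in>Pow {..<d}. cmod (f (x + (\<Sum>i\<in>S. h i))) + cmod (g (x + (\<Sum>i\<in>S. h i))))"
      unfolding norm_cube_family by (intro prod_mono conjI norm_ge_zero norm_triangle_ineq)
    also have "\<dots> = (\<Sum>X\<in>Pow (Pow {..<d}). cmod (cube_family d (\<lambda>S. if S \<in> X then f else g) h x))"
      unfolding norm_cube_family by (subst prod_add_if) (auto intro!: sum.cong prod.cong)
    finally show ?thesis .
  qed
  then have "R_abs d (\<lambda>_ x. f x + g x) h \<le>
      (\<integral>\<^sup>+x. (\<Sum>X\<in>Pow (Pow {..<d}). ennreal (cmod (cube_family d (\<lambda>S. if S \<in> X then f else g) h x))) \<partial>\<mu>)"
    unfolding R_abs_def by (intro nn_integral_mono) (simp add: sum_ennreal ennreal_leI)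
  also have "\<dots> = (\<Sum>X\<in>Pow (Pow {..<d}). R_abs d (\<lambda>S. if S \<in> X then f else g) h)"
    unfolding R_abs_def by (intro nn_integral_sum) simp
  finally show ?thesis .
qed

text \<open>The product over the vertices is expanded as in \<open>R_abs_add_le\<close>;
  \<open>fin\<close> makes every term integrable, so that the integral of the sum can be
  split.\<close>

lemma R_family_add:
  assumes [measurable]: "f \<in> borel_measurable borel" "g \<in> borel_measurable borel"
    and [measurable]: "h \<in> space (prod_measure d \<mu>)"
    and fin: "\<And>X. R_abs d (\<lambda>S. if S \<in> X then f else g) h < \<infinity>"
  shows "R_family d (\<lambda>_ x. f x + g x) h = (\<Sum>X\<in>Pow (Pow {..<d}). R_family d (\<lambda>S. if S \<in> X then f else g) h)"
proof -
  have [measurable]: "(\<lambda>(h, x). cube_family d (\<lambda>S. if S \<in> X then f else g) h x)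
      \<in> borel_measurable (prod_measure d \<mu> \<Otimes>\<^sub>M borel)" for X
    by (rule measurable_cube_family) simp
  have "cube_family d (\<lambda>_ x. f x + g x) h = (\<lambda>x.
      \<Sum>X\<in>Pow (Pow {..<d}). cube_family d (\<lambda>S. if S \<in> X then f else g) h x)"
  proof
    fix x
    have "cube_family d (\<lambda>_ x. f x + g x) h x =
      (\<Prod>S\<in>Pow {..<d}. (cnj ^^ (d - card S)) (f (x + (\<Sum>i\<in>S. h i))) + (cnj ^^ (d - card S)) (g (x + (\<Sum>i\<in>S. h i))))"
      unfolding cube_family_def by (intro prod.cong refl) (simp add: cnj_funpow)
    also have "\<dots> = (\<Sum>X\<in>Pow (Pow {..<d}). cube_family d (\<lambda>S. if S \<in> X then f else g) h x)"
      unfolding cube_family_def by (subst prod_add_if) (auto intro!: sum.cong prod.cong)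
    finally show "cube_family d (\<lambda>_ x. f x + g x) h x =
      (\<Sum>X\<in>Pow (Pow {..<d}). cube_family d (\<lambda>S. if S \<in> X then f else g) h x)" .
  qed
  moreover have "integrable \<mu> (cube_family d (\<lambda>S. if S \<in> X then f else g) h)" for X
    using fin[of X] unfolding R_abs_def by (intro integrableI_bounded) auto
  ultimately show ?thesis unfolding R_family_def by simp
qed

lemma N_abs_add:
  assumes [measurable]: "f \<in> borel_measurable borel" "g \<in> borel_measurable borel"
    and "a > 0" "b > 0" "p > 0"
    and "N_abs d p (\<lambda>_. f) \<le> ennreal (a ^ (2 ^ d * p))" "N_abs d p (\<lambda>_. g) \<le> ennreal (b ^ (2 ^ d * p))"
  shows "N_abs d p (\<lambda>_ x. f x + g x) \<le> ennreal ((a + b) ^ (2 ^ d * p))"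
proof -
  have m: "(if S \<in> X then f else g) \<in> borel_measurable borel" for S and X :: "nat set set" by simp
  show ?thesis
    unfolding N_abs_def
  proof (rule Gowers_triangle[where r = "R_abs d" and f = f and g = g])
    fix X :: "nat set set"
    show "(\<integral>\<^sup>+h. R_abs d (\<lambda>S. if S \<in> X then f else g) h ^ p \<partial>prod_measure d \<mu>) ^ 2 ^ d \<le>
        (\<Prod>T\<in>Pow {..<d}. \<integral>\<^sup>+h. R_abs d (\<lambda>_. if T \<in> X then f else g) h ^ p \<partial>prod_measure d \<mu>)"
      by (rule N_abs_Gowers_Cauchy_Schwarz[unfolded N_abs_def]) (use m \<open>p > 0\<close> in simp_all)
    show "R_abs d (\<lambda>S. if S \<in> X then f else g) \<in> borel_measurable (prod_measure d \<mu>)"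
      by (rule measurable_R(2)) (rule m)
    show "AE h in prod_measure d \<mu>. R_abs d (\<lambda>_ x. f x + g x) h \<le>
        (\<Sum>X\<in>Pow (Pow {..<d}). R_abs d (\<lambda>S. if S \<in> X then f else g) h)"
      by (rule AE_I2) (rule R_abs_add_le[OF assms(1,2)])
  qed (use assms in \<open>simp_all add: N_abs_def\<close>)
qed

lemma AE_R_abs_finite:
  assumes "\<And>S. F S \<in> borel_measurable borel" "N_abs d p F < \<infinity>" "p > 0"
  shows "AE h in prod_measure d \<mu>. R_abs d F h < \<infinity>"
proof -
  have "AE h in prod_measure d \<mu>. R_abs d F h ^ p \<noteq> \<infinity>"
    using assms(2) measurable_R(2)[where F = F, OF assms(1)] unfolding N_abs_def
    by (intro nn_integral_PInf_AE) auto
  then show ?thesis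
    using assms(3) by (auto elim!: eventually_mono simp: power_eq_top_ennreal less_top)
qed

lemma N_family_add:
  assumes [measurable]: "f \<in> borel_measurable borel" "g \<in> borel_measurable borel"
    and fin: "N_abs d p (\<lambda>_. f) < \<infinity>" "N_abs d p (\<lambda>_. g) < \<infinity>"
    and "a > 0" "b > 0" "p > 0" "even p"
    and "N_family d p (\<lambda>_. f) \<le> ennreal (a ^ (2 ^ d * p))" "N_family d p (\<lambda>_. g) \<le> ennreal (b ^ (2 ^ d * p))"
  shows "N_family d p (\<lambda>_ x. f x + g x) \<le> ennreal ((a + b) ^ (2 ^ d * p))"
proof -
  have m: "(if S \<in> X then f else g) \<in> borel_measurable borel" for S and X :: "nat set set" by simp
  have fin': "N_abs d p (\<lambda>_. if S \<in> X then f else g) < \<infinity>" for S and X :: "nat set set"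
    using fin by simp
  have "AE h in prod_measure d \<mu>. R_abs d (\<lambda>S. if S \<in> X then f else g) h < \<infinity>" for X
    by (rule AE_R_abs_finite[OF m N_abs_family_finite[OF m fin' \<open>p > 0\<close>] \<open>p > 0\<close>])
  then have "AE h in prod_measure d \<mu>. \<forall>X\<in>Pow (Pow {..<d}). R_abs d (\<lambda>S. if S \<in> X then f else g) h < \<infinity>"
    by (intro AE_finite_allI) simp
  then have "AE h in prod_measure d \<mu>. ennreal (cmod (R_family d (\<lambda>_ x. f x + g x) h)) \<le>
    (\<Sum>X\<in>Pow (Pow {..<d}). ennreal (cmod (R_family d (\<lambda>S. if S \<in> X then f else g) h)))"
    using AE_space
  proof eventually_elim
    case (elim h)
    \<comment> \<open>\<open>elim(1)\<close> speaks only of sets \<open>X\<close> of vertices of the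
      cube. Any other \<open>X\<close> may be intersected with the set of vertices without changing
      the cube product.\<close>
    have "R_abs d (\<lambda>S. if S \<in> X then f else g) h < \<infinity>" for X
    proof -
      have "R_abs d (\<lambda>S. if S \<in> X then f else g) h = R_abs d (\<lambda>S. if S \<in> X \<inter> Pow {..<d} then f else g) h"
        unfolding R_abs_def
        using cube_family_cong[of d "\<lambda>S. if S \<in> X then f else g" "\<lambda>S. if S \<in> X \<inter> Pow {..<d} then f else g"]
        by simp
      also have "\<dots> < \<infinity>" using elim(1) by blast
      finally show ?thesis .
    qed
    from R_family_add[OF assms(1,2) elim(2) this]
    have "cmod (R_family d (\<lambda>_ x. f x + g x) h) \<le>
        (\<Sum>X\<in>Pow (Pow {..<d}). cmod (R_family d (\<lambda>S. if S \<in> X then f else g) h))"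
      by (simp only:) (rule norm_sum)
    then show ?case by (simp add: sum_ennreal ennreal_leI)
  qed
  note expand = this
  show ?thesis
    unfolding N_family_def
  proof (rule Gowers_triangle[where r = "\<lambda>F h. ennreal (cmod (R_family d F h))" and f = f and g = g])
    fix X :: "nat set set"
    show "(\<integral>\<^sup>+h. ennreal (cmod (R_family d (\<lambda>S. if S \<in> X then f else g) h)) ^ p \<partial>prod_measure d \<mu>) ^ 2 ^ d \<le>
        (\<Prod>T\<in>Pow {..<d}. \<integral>\<^sup>+h. ennreal (cmod (R_family d (\<lambda>_. if T \<in> X then f else g) h)) ^ p \<partial>prod_measure d \<mu>)"
      by (rule N_family_Gowers_Cauchy_Schwarz[unfolded N_family_def])
        (use m fin' \<open>p > 0\<close> \<open>even p\<close> in simp_all)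
    have [measurable]: "R_family d (\<lambda>S. if S \<in> X then f else g) \<in> borel_measurable (prod_measure d \<mu>)"
      by (rule measurable_R(1)) (rule m)
    show "(\<lambda>h. ennreal (cmod (R_family d (\<lambda>S. if S \<in> X then f else g) h))) \<in> borel_measurable (prod_measure d \<mu>)"
      by measurable
  qed (use assms(5-7,9,10) expand in \<open>simp_all add: N_family_def\<close>)
qed

end

section \<open>Definiteness\<close>

lemma cube_family_0: "cube_family 0 F h = F {}"
  by (simp add: cube_family_def fun_eq_iff)

text \<open>Fixing the last direction \<open>t\<close> replaces \<open>f\<close> by its
  multiplicative derivative \<open>cnj (f x) * f (x + t)\<close> in a cube of one dimension less.
  The inductions on \<open>d\<close> rest on this.\<close>

lemma cube_family_Suc:
  "cube_family (Suc d) (\<lambda>_. f) (h(d := t)) = cube_family d (\<lambda>_ x. cnj (f x) * f (x + t)) h"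
proof
  fix x
  have *: "facet (Suc d) ({..<Suc d} - {d}) (\<lambda>_. f) h y = (\<Prod>S\<in>Pow {..<d}. (cnj ^^ (d - card S)) (f (y + (\<Sum>i\<in>S. h i))))" for y
  proof -
    have "{..<Suc d} - {d} = {..<d}" by auto
    then show ?thesis by (simp add: facet_def)
  qed
  have "cube_family (Suc d) (\<lambda>_. f) (h(d := t)) x =
     (\<Prod>S\<in>Pow {..<d}. cnj ((cnj ^^ (d - card S)) (f (x + (\<Sum>i\<in>S. h i)))) * (cnj ^^ (d - card S)) (f (x + t + (\<Sum>i\<in>S. h i))))"
    by (simp add: cube_family_split * prod.distrib cnj_prod)
  also have "\<dots> = cube_family d (\<lambda>_ x. cnj (f x) * f (x + t)) h x"
    unfolding cube_family_def by (intro prod.cong refl) (simp add: cnj_funpow ac_simps)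
  finally show "cube_family (Suc d) (\<lambda>_. f) (h(d := t)) x = cube_family d (\<lambda>_ x. cnj (f x) * f (x + t)) h x" .
qed

context translation_invariant_measure
begin

lemma emeasure_space_PiM_empty: "emeasure (PiM {} (\<lambda>_::nat. \<mu>)) (space (PiM {} (\<lambda>_::nat. \<mu>))) = 1"
  by (simp add: PiM_empty)

text \<open>The case \<open>q = 0\<close> of \<open>nn_correlation_power\<close>: the product space
  is then a single point of mass 1.\<close>

lemma nn_correlation_integral:
  fixes a b :: "'a \<Rightarrow> ennreal"
  assumes "a \<in> borel_measurable borel" "b \<in> borel_measurable borel"
  shows "(\<integral>\<^sup>+t. \<integral>\<^sup>+x. a x * b (x + t) \<partial>\<mu> \<partial>\<mu>) = (\<integral>\<^sup>+x. a x \<partial>\<mu>) * (\<integral>\<^sup>+x. b x \<partial>\<mu>)"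
  using nn_correlation_power[OF assms, of 0] by (simp add: emeasure_space_PiM_empty)

lemma AE_zero_of_translates:
  fixes f :: "'a \<Rightarrow> complex"
  assumes [measurable]: "f \<in> borel_measurable borel"
    and "AE t in \<mu>. AE x in \<mu>. cnj (f x) * f (x + t) = 0"
  shows "AE x in \<mu>. f x = 0"
proof -
  have "(\<integral>\<^sup>+x. ennreal (cmod (f x)) \<partial>\<mu>) * (\<integral>\<^sup>+x. ennreal (cmod (f x)) \<partial>\<mu>) =
      (\<integral>\<^sup>+t. \<integral>\<^sup>+x. ennreal (cmod (f x)) * ennreal (cmod (f (x + t))) \<partial>\<mu> \<partial>\<mu>)"
    by (rule nn_correlation_integral[symmetric]) measurable
  also have "\<dots> = (\<integral>\<^sup>+t. 0 \<partial>\<mu>)"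
  proof (rule nn_integral_cong_AE)
    show "AE t in \<mu>. (\<integral>\<^sup>+x. ennreal (cmod (f x)) * ennreal (cmod (f (x + t))) \<partial>\<mu>) = 0"
      using assms(2)
    proof eventually_elim
      case (elim t)
      then have "AE x in \<mu>. ennreal (cmod (f x)) * ennreal (cmod (f (x + t))) = 0"
        by (auto elim!: eventually_mono)
      then show ?case by (subst nn_integral_0_iff_AE) auto
    qed
  qed
  finally have "(\<integral>\<^sup>+x. ennreal (cmod (f x)) \<partial>\<mu>) = 0" by simp
  then show ?thesis by (simp add: nn_integral_0_iff_AE)
qed

lemma nn_integral_prod_measure_Suc:
  assumes [measurable]: "f \<in> borel_measurable (prod_measure (Suc d) \<mu>)"
  shows "(\<integral>\<^sup>+h. f h \<partial>prod_measure (Suc d) \<mu>) = (\<integral>\<^sup>+t. \<integral>\<^sup>+h. f (h(d := t)) \<partial>prod_measure d \<mu> \<partial>\<mu>)"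
    and "(\<lambda>t. \<integral>\<^sup>+h. f (h(d := t)) \<partial>prod_measure d \<mu>) \<in> borel_measurable \<mu>"
proof -
  have [measurable]: "f \<in> borel_measurable (PiM (insert d {..<d}) (\<lambda>_. \<mu>))"
    using assms by (simp add: lessThan_Suc)
  interpret Y: sigma_finite_measure "prod_measure d \<mu>" by (rule P.sigma_finite) simp
  show "(\<integral>\<^sup>+h. f h \<partial>prod_measure (Suc d) \<mu>) = (\<integral>\<^sup>+t. \<integral>\<^sup>+h. f (h(d := t)) \<partial>prod_measure d \<mu> \<partial>\<mu>)"
    using P.product_nn_integral_insert_rev[of "{..<d}" d f] by (simp add: lessThan_Suc)
  show "(\<lambda>t. \<integral>\<^sup>+h. f (h(d := t)) \<partial>prod_measure d \<mu>) \<in> borel_measurable \<mu>"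
    by measurable
qed

lemma N_abs_Suc:
  assumes [measurable]: "f \<in> borel_measurable borel"
  shows "N_abs (Suc d) p (\<lambda>_. f) = (\<integral>\<^sup>+t. N_abs d p (\<lambda>_ x. cnj (f x) * f (x + t)) \<partial>\<mu>)"
    and "(\<lambda>t. N_abs d p (\<lambda>_ x. cnj (f x) * f (x + t))) \<in> borel_measurable \<mu>"
proof -
  have [measurable]: "R_abs (Suc d) (\<lambda>_. f) \<in> borel_measurable (prod_measure (Suc d) \<mu>)"
    by (rule measurable_R(2)) simp
  have "(\<lambda>h. R_abs (Suc d) (\<lambda>_. f) h ^ p) \<in> borel_measurable (prod_measure (Suc d) \<mu>)"
    by measurable
  note * = nn_integral_prod_measure_Suc[OF this, unfolded R_abs_def cube_family_Suc]
  show "N_abs (Suc d) p (\<lambda>_. f) = (\<integral>\<^sup>+t. N_abs d p (\<lambda>_ x. cnj (f x) * f (x + t)) \<partial>\<mu>)"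
    "(\<lambda>t. N_abs d p (\<lambda>_ x. cnj (f x) * f (x + t))) \<in> borel_measurable \<mu>"
    unfolding N_abs_def R_abs_def using * by simp_all
qed

lemma N_family_Suc:
  assumes [measurable]: "f \<in> borel_measurable borel"
  shows "N_family (Suc d) p (\<lambda>_. f) = (\<integral>\<^sup>+t. N_family d p (\<lambda>_ x. cnj (f x) * f (x + t)) \<partial>\<mu>)"
    and "(\<lambda>t. N_family d p (\<lambda>_ x. cnj (f x) * f (x + t))) \<in> borel_measurable \<mu>"
proof -
  have [measurable]: "R_family (Suc d) (\<lambda>_. f) \<in> borel_measurable (prod_measure (Suc d) \<mu>)"
    by (rule measurable_R(1)) simp
  have "(\<lambda>h. ennreal (cmod (R_family (Suc d) (\<lambda>_. f) h)) ^ p) \<in> borel_measurable (prod_measure (Suc d) \<mu>)"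
    by measurable
  note * = nn_integral_prod_measure_Suc[OF this, unfolded R_family_def cube_family_Suc]
  show "N_family (Suc d) p (\<lambda>_. f) = (\<integral>\<^sup>+t. N_family d p (\<lambda>_ x. cnj (f x) * f (x + t)) \<partial>\<mu>)"
    "(\<lambda>t. N_family d p (\<lambda>_ x. cnj (f x) * f (x + t))) \<in> borel_measurable \<mu>"
    unfolding N_family_def R_family_def using * by simp_all
qed

text \<open>The induction can start at \<open>d = 0\<close>, where \<open>N_abs\<close> is the
  \<open>p\<close>-th power of the integral of the modulus of \<open>f\<close>.\<close>

lemma N_abs_definite:
  assumes "f \<in> borel_measurable borel" "N_abs d p (\<lambda>_. f) = 0" "p > 0"
  shows "AE x in \<mu>. f x = 0"
  using assms(1,2)
proof (induction d arbitrary: f)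
  case 0
  then show ?case using \<open>p > 0\<close>
    by (simp add: N_abs_def R_abs_def cube_family_0 emeasure_space_PiM_empty nn_integral_0_iff_AE)
next
  case (Suc d)
  note Suc.prems(1)[measurable]
  have "AE t in \<mu>. N_abs d p (\<lambda>_ x. cnj (f x) * f (x + t)) = 0"
    using Suc.prems(2) N_abs_Suc(2)[OF Suc.prems(1), of d p]
    by (simp add: N_abs_Suc(1)[OF Suc.prems(1)] nn_integral_0_iff_AE)
  then have "AE t in \<mu>. AE x in \<mu>. cnj (f x) * f (x + t) = 0"
    by (rule eventually_mono) (rule Suc.IH, measurable)
  then show ?case by (rule AE_zero_of_translates[OF Suc.prems(1)])
qed

lemma N_abs_1:
  assumes "\<And>S. F S \<in> borel_measurable borel"
  shows "N_abs 1 p F = (\<integral>\<^sup>+t. (\<integral>\<^sup>+x. ennreal (cmod (F {} x)) * ennreal (cmod (F {0} (x + t))) \<partial>\<mu>) ^ p \<partial>\<mu>)"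
  using N_abs_split[where F = F and i = 0 and d = 1, OF _ assms] 
  by (simp add: lessThan_Suc facet_def emeasure_space_PiM_empty)

lemma N_family_1:
  assumes "\<And>S. F S \<in> borel_measurable borel"
  shows "N_family 1 p F = (\<integral>\<^sup>+t. ennreal (cmod (LINT x|\<mu>. cnj (F {} x) * F {0} (x + t)) ^ p) \<partial>\<mu>)"
  using N_family_split[where F = F and i = 0 and d = 1, OF _ assms] 
  by (simp add: lessThan_Suc facet_def emeasure_space_PiM_empty)

text \<open>Indicators serve as test functions. All but one of the \<open>p\<close> factors are
  bounded by the measure of \<open>B\<close>, and the remaining one integrates over \<open>t\<close>
  to the square of that measure.\<close>

lemma N_abs_1_indicator_finite:
  assumes [measurable]: "B \<in> sets borel" and fin: "emeasure \<mu> B < \<infinity>" and p: "p > 0"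
  shows "N_abs 1 p (\<lambda>_. indicator B) < \<infinity>"
proof -
  obtain q where q: "p = Suc q" using p gr0_implies_Suc by blast
  have ind: "ennreal (cmod (indicator B x)) = indicator B x" for x :: 'a
    by (simp add: indicator_def)
  have "N_abs 1 p (\<lambda>_. indicator B) = (\<integral>\<^sup>+t. (\<integral>\<^sup>+x. indicator B x * indicator B (x + t) \<partial>\<mu>) ^ Suc q \<partial>\<mu>)"
    by (subst N_abs_1) (simp_all add: ind q)
  also have "\<dots> \<le> (\<integral>\<^sup>+t. (\<integral>\<^sup>+x. indicator B x * indicator B (x + t) \<partial>\<mu>) * emeasure \<mu> B ^ q \<partial>\<mu>)"
  proof (intro nn_integral_mono)
    fix t
    have "(\<integral>\<^sup>+x. indicator B x * indicator B (x + t) \<partial>\<mu>) \<le> (\<integral>\<^sup>+x. indicator B x \<partial>\<mu>)"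
      by (intro nn_integral_mono) (auto simp: indicator_def)
    also have "\<dots> = emeasure \<mu> B" by simp
    finally show "(\<integral>\<^sup>+x. indicator B x * indicator B (x + t) \<partial>\<mu>) ^ Suc q \<le>
        (\<integral>\<^sup>+x. indicator B x * indicator B (x + t) \<partial>\<mu>) * emeasure \<mu> B ^ q"
      unfolding power_Suc by (intro mult_left_mono power_mono_ennreal) auto
  qed
  also have "\<dots> = emeasure \<mu> B * emeasure \<mu> B * emeasure \<mu> B ^ q"
    by (simp add: nn_integral_multc nn_correlation_integral)
  also have "\<dots> < \<infinity>" using fin by (simp add: ennreal_mult_less_top power_less_top_ennreal)
  finally show ?thesis .
qed

end

section \<open>Local compactness and definiteness for complex functions\<close>

lemma open_translation: "open (U :: 'a::topological_ab_group_add set) \<Longrightarrow> open ((\<lambda>x. x + a) -` U)"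
  by (rule open_vimage) (auto intro!: continuous_intros)

text \<open>Translates of \<open>W\<close> cover the group, countably many suffice by Lindelof, and
  each lies in a compact translate of \<open>K\<close>. This gives sigma-finiteness of a Haar
  measure and the passage from compact sets to the whole group.\<close>

lemma countable_compact_cover:
  fixes W K :: "'a::{topological_ab_group_add, second_countable_topology, t2_space} set"
  assumes WK: "open W" "compact K" "0 \<in> W" "W \<subseteq> K"
  obtains \<C> :: "'a set set" where "countable \<C>" "\<And>C. C \<in> \<C> \<Longrightarrow> compact C" "\<Union>\<C> = UNIV"
proof -
  have "open S" if "S \<in> range (\<lambda>a. (\<lambda>x. x + a) -` W)" for S
    using that open_translation[OF WK(1)] by auto
  then obtain \<F> where F: "\<F> \<subseteq> range (\<lambda>a. (\<lambda>x. x + a) -` W)" "countable \<F>"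
      "\<Union>\<F> = \<Union>(range (\<lambda>a. (\<lambda>x. x + a) -` W))"
    using Lindelof by blast
  then obtain A where A: "countable A" "\<F> = (\<lambda>a. (\<lambda>x. x + a) -` W) ` A"
    using countable_subset_image[of \<F> "\<lambda>a. (\<lambda>x. x + a) -` W" UNIV] by blast
  have sub: "(\<lambda>x. x + a) -` W \<subseteq> (\<lambda>x. x - a) ` K" for a
  proof
    fix x assume "x \<in> (\<lambda>x. x + a) -` W"
    then have "x + a \<in> K" using WK(4) by auto
    then show "x \<in> (\<lambda>x. x - a) ` K" by (intro image_eqI[of _ _ "x + a"]) auto
  qed
  show thesis
  proof (rule that)
    show "countable ((\<lambda>a. (\<lambda>x. x - a) ` K) ` A)" using A(1) by (rule countable_image)
    show "compact C" if C: "C \<in> (\<lambda>a. (\<lambda>x. x - a) ` K) ` A" for C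
    proof -
      obtain a where "C = (\<lambda>x. x - a) ` K" using C by blast
      moreover have "continuous_on K (\<lambda>x. x - a)" by (intro continuous_intros)
      ultimately show ?thesis using compact_continuous_image WK(2) by blast
    qed
    show "\<Union>((\<lambda>a. (\<lambda>x. x - a) ` K) ` A) = UNIV"
    proof (intro equalityI subsetI UNIV_I)
      fix x :: 'a
      have "x \<in> (\<lambda>z. z + (- x)) -` W" using WK(3) by simp
      then have "x \<in> \<Union>\<F>" unfolding F(3) by blast
      then obtain a where "a \<in> A" "x \<in> (\<lambda>x. x + a) -` W" unfolding A(2) by blast
      then show "x \<in> \<Union>((\<lambda>a. (\<lambda>x. x - a) ` K) ` A)" using sub[of a] by blast
    qed
  qed
qed

text \<open>Local compactness is recorded at \<open>0\<close> alone; translations carry it to all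
  other points.\<close>

locale haar_space = translation_invariant_measure \<mu>
  for \<mu> :: "'a::{topological_ab_group_add, second_countable_topology, t2_space} measure" +
  assumes compact_finite: "\<And>K. compact K \<Longrightarrow> emeasure \<mu> K < \<infinity>"
    and compact_nhd: "\<exists>W K. open W \<and> compact K \<and> (0::'a) \<in> W \<and> W \<subseteq> K"
    and nonzero: "emeasure \<mu> UNIV \<noteq> 0"
begin

lemma compact_sum: "compact A \<Longrightarrow> compact B \<Longrightarrow> compact {x + y | x y. x \<in> A \<and> y \<in> (B :: 'a set)}"
proof -
  assume "compact A" "compact B"
  then have "compact ((\<lambda>(x, y). x + y) ` (A \<times> B))"
    by (intro compact_continuous_image compact_Times)
      (auto simp: case_prod_beta intro!: continuous_intros)
  also have "(\<lambda>(x, y). x + y) ` (A \<times> B) = {x + y | x y. x \<in> A \<and> y \<in> B}" by auto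
  finally show ?thesis .
qed

lemma borel_compact: "compact (K :: 'a set) \<Longrightarrow> K \<in> sets borel"
  by (simp add: compact_imp_closed)

text \<open>If \<open>U\<close> were null, so would be its translates, and countably many of them
  cover the group.\<close>

lemma open_positive:
  assumes "open U" "U \<noteq> {}"
  shows "emeasure \<mu> U \<noteq> 0"
proof
  assume null: "emeasure \<mu> U = 0"
  obtain u where u: "u \<in> U" using assms(2) by blast
  define \<F> where "\<F> = range (\<lambda>a. (\<lambda>x. x + a) -` U)"
  have "open S" if "S \<in> \<F>" for S
    using that open_translation[OF assms(1)] by (auto simp: \<F>_def)
  then obtain \<F>' where F: "\<F>' \<subseteq> \<F>" "countable \<F>'" "\<Union>\<F>' = \<Union>\<F>"
    using Lindelof by blast
  have "S \<in> null_sets \<mu>" if S: "S \<in> \<F>" for S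
  proof -
    obtain a where S: "S = (\<lambda>x. x + a) -` U" using S by (auto simp: \<F>_def)
    have "emeasure \<mu> U = emeasure (distr \<mu> borel (\<lambda>x. x + a)) U" by (simp add: distr_translation)
    also have "\<dots> = emeasure \<mu> S" using assms(1) by (subst emeasure_distr) (auto simp: S)
    finally show ?thesis
      using null open_translation[OF assms(1), of a] by (auto simp: S null_sets_def sets_eq_borel)
  qed
  then have "\<Union>\<F>' \<in> null_sets \<mu>"
    using null_sets_UN'[OF F(2), of id] F(1) by auto
  moreover have "\<Union>\<F> = UNIV"
  proof -
    have "x \<in> (\<lambda>z. z + (u - x)) -` U" for x using u by simp
    then show ?thesis unfolding \<F>_def by blast
  qed
  ultimately show False using F(3) nonzero by (simp add: null_sets_def)
qed

lemma AE_obtain_in_open: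
  assumes "AE x in \<mu>. P x" "open U" "U \<noteq> {}"
  obtains x where "x \<in> U" "P x"
proof -
  obtain N where N: "{x. \<not> P x} \<subseteq> N" "emeasure \<mu> N = 0" "N \<in> sets \<mu>"
    using assms(1) by (auto elim!: AE_E)
  have "\<not> U \<subseteq> N"
    using N(2,3) open_positive[OF assms(2,3)] emeasure_mono[of U N \<mu>] by auto
  then show thesis using N(1) that by blast
qed

text \<open>The correlation of the modulus of \<open>f\<close> with the indicator of
  \<open>B = C + K\<close> is finite for almost every \<open>t\<close>, hence for some
  \<open>t\<close> in \<open>W\<close>. For such \<open>t\<close> the translate \<open>B - t\<close>
  still contains \<open>C\<close>, so the correlation bounds the integral over
  \<open>C\<close>.\<close>

lemma locally_integrable:
  fixes f :: "'a \<Rightarrow> complex"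
  assumes f[measurable]: "f \<in> borel_measurable borel" and fin: "N_abs 1 p (\<lambda>_. f) < \<infinity>" and p: "p > 0"
    and C: "compact C"
  shows "integrable \<mu> (\<lambda>x. indicator C x *\<^sub>R f x)"
proof (rule integrableI_bounded)
  obtain W K where WK: "open W" "compact K" "(0::'a) \<in> W" "W \<subseteq> K" using compact_nhd by blast
  define B where "B = {x + y | x y. x \<in> C \<and> y \<in> K}"
  have B: "compact B" unfolding B_def by (rule compact_sum[OF C WK(2)])
  have [measurable]: "B \<in> sets borel" "C \<in> sets borel" by (simp_all add: borel_compact B C)
  define F where "F = (\<lambda>S::nat set. if S = {} then f else indicator B)"
  have F: "F S \<in> borel_measurable borel" "N_abs 1 p (\<lambda>_. F S) < \<infinity>" for S
    using fin N_abs_1_indicator_finite[OF _ compact_finite[OF B] p] by (auto simp: F_def)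
  have "N_abs 1 p F < \<infinity>" by (rule N_abs_family_finite[OF F p])
  moreover have "N_abs 1 p F = (\<integral>\<^sup>+t. (\<integral>\<^sup>+x. ennreal (cmod (f x)) * indicator B (x + t) \<partial>\<mu>) ^ p \<partial>\<mu>)"
    by (subst N_abs_1[OF F(1)]) (auto simp: F_def indicator_def intro!: nn_integral_cong arg_cong[where f = "\<lambda>z. z ^ p"])
  ultimately have "AE t in \<mu>. (\<integral>\<^sup>+x. ennreal (cmod (f x)) * indicator B (x + t) \<partial>\<mu>) ^ p \<noteq> \<infinity>"
    by (intro nn_integral_PInf_AE) auto
  then obtain t where t: "t \<in> W" "(\<integral>\<^sup>+x. ennreal (cmod (f x)) * indicator B (x + t) \<partial>\<mu>) ^ p \<noteq> \<infinity>"
    using AE_obtain_in_open[of _ W] WK(1,3) by blast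
  have "(\<integral>\<^sup>+x. ennreal (norm (indicator C x *\<^sub>R f x)) \<partial>\<mu>) \<le> (\<integral>\<^sup>+x. ennreal (cmod (f x)) * indicator B (x + t) \<partial>\<mu>)"
    using t(1) WK(4) by (intro nn_integral_mono) (auto simp: indicator_def B_def)
  also have "\<dots> < \<infinity>" using t(2) p by (auto simp: power_eq_top_ennreal less_top)
  finally show "(\<integral>\<^sup>+x. ennreal (norm (indicator C x *\<^sub>R f x)) \<partial>\<mu>) < \<infinity>" .
  show "(\<lambda>x. indicator C x *\<^sub>R f x) \<in> borel_measurable \<mu>" by measurable
qed

text \<open>
  Testing against indicators of open sets \<open>K + V\<^sub>n\<close> shrinking to the compact set \<open>K\<close>, the correlation
  vanishes for some \<open>t\<^sub>n \<in> V\<^sub>n\<close>; then \<open>K + V\<^sub>n - t\<^sub>n\<close> still contains \<open>K\<close> and shrinks to it.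
\<close>

lemma integral_compact_eq_0:
  fixes f :: "'a \<Rightarrow> complex"
  assumes f[measurable]: "f \<in> borel_measurable borel"
    and locint: "\<And>C. compact C \<Longrightarrow> integrable \<mu> (\<lambda>x. indicator C x *\<^sub>R f x)"
    and orth: "\<And>B. open B \<Longrightarrow> emeasure \<mu> B < \<infinity> \<Longrightarrow> AE t in \<mu>. (LINT x|\<mu>. indicator B (x + t) *\<^sub>R f x) = 0"
    and K: "compact K"
  shows "(LINT x|\<mu>. indicator K x *\<^sub>R f x) = 0"
proof -
  obtain W L where WL: "open W" "compact L" "(0::'a) \<in> W" "W \<subseteq> L" using compact_nhd by blast
  obtain A :: "nat \<Rightarrow> 'a set" where A: "\<And>n. open (A n)" "\<And>n. 0 \<in> A n"
    "\<And>s. (\<forall>n. s n \<in> A n) \<Longrightarrow> s \<longlonglongrightarrow> 0"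
    using first_countable_topology_class.countable_basis[of "0::'a"] by metis
  \<comment> \<open>Intersecting with \<open>W\<close> keeps all the sets \<open>K + V n\<close>
    inside the single compact set \<open>K + L\<close>.\<close>
  define V where "V n = A n \<inter> W" for n
  have V: "open (V n)" "0 \<in> V n" "V n \<subseteq> L" for n using A WL by (auto simp: V_def)
  define B where "B n = (\<Union>k\<in>K. (\<lambda>x. x + (- k)) -` V n)" for n
  have B_iff: "x \<in> B n \<longleftrightarrow> (\<exists>k\<in>K. x - k \<in> V n)" for x n by (auto simp: B_def)
  have B: "open (B n)" for n unfolding B_def by (intro open_UN ballI open_translation V)
  have KL: "compact {x + y | x y. x \<in> K \<and> y \<in> L}" by (rule compact_sum[OF K WL(2)])
  have BKL: "B n \<subseteq> {x + y | x y. x \<in> K \<and> y \<in> L}" for n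
  proof
    fix x assume "x \<in> B n"
    then obtain k where "k \<in> K" "x - k \<in> V n" by (auto simp: B_iff)
    then have "k \<in> K" "x - k \<in> L" "x = k + (x - k)" using V(3) by auto
    then show "x \<in> {x + y | x y. x \<in> K \<and> y \<in> L}" by blast
  qed
  have "emeasure \<mu> (B n) < \<infinity>" for n
    using emeasure_mono[OF BKL[of n], of \<mu>] compact_finite[OF KL] borel_compact[OF KL]
    by (auto simp: sets_eq_borel)
  from orth[OF B this] have "\<exists>t. t \<in> V n \<and> (LINT x|\<mu>. indicator (B n) (x + t) *\<^sub>R f x) = 0" for n
    using AE_obtain_in_open[of "\<lambda>t. (LINT x|\<mu>. indicator (B n) (x + t) *\<^sub>R f x) = 0" "V n"] V(1,2)[of n] by blast
  then obtain t where t: "\<And>n. t n \<in> V n" "\<And>n. (LINT x|\<mu>. indicator (B n) (x + t n) *\<^sub>R f x) = 0"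
    by metis
  have t0: "t \<longlonglongrightarrow> 0" using t(1) by (intro A(3)) (auto simp: V_def)
  \<comment> \<open>A compact set containing all the translates \<open>B n - t n\<close>; restricted
    to it, \<open>f\<close> gives the integrable majorant for dominated convergence.\<close>
  define D where "D = {x + y | x y. x \<in> {x + y | x y. x \<in> K \<and> y \<in> L} \<and> y \<in> uminus ` L}"
  have "compact (uminus ` L)"
    by (intro compact_continuous_image WL(2) continuous_intros)
  then have D: "compact D" unfolding D_def by (rule compact_sum[OF KL])
  have [measurable]: "K \<in> sets borel" "B n \<in> sets borel" for n
    using K B by (auto simp: borel_compact)
  have "(\<lambda>n. LINT x|\<mu>. indicator (B n) (x + t n) *\<^sub>R f x) \<longlonglongrightarrow> (LINT x|\<mu>. indicator K x *\<^sub>R f x)"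
  proof (rule integral_dominated_convergence)
    show "integrable \<mu> (\<lambda>x. norm (indicator D x *\<^sub>R f x))"
      by (intro integrable_norm locint D)
    show "AE x in \<mu>. norm (indicator (B n) (x + t n) *\<^sub>R f x) \<le> norm (indicator D x *\<^sub>R f x)" for n
    proof (rule AE_I2)
      fix x
      have "x \<in> D" if "x + t n \<in> B n"
      proof -
        have "x + t n \<in> {x + y | x y. x \<in> K \<and> y \<in> L}" "- t n \<in> uminus ` L"
          using BKL that t(1)[of n] V(3)[of n] by auto
        moreover have "x = (x + t n) + (- t n)" by simp
        ultimately show ?thesis unfolding D_def by blast
      qed
      then show "norm (indicator (B n) (x + t n) *\<^sub>R f x) \<le> norm (indicator D x *\<^sub>R f x)"
        by (auto simp: indicator_def)
    qed
    show "AE x in \<mu>. (\<lambda>n. indicator (B n) (x + t n) *\<^sub>R f x) \<longlonglongrightarrow> indicator K x *\<^sub>R f x"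
    proof (rule AE_I2)
      fix x
      have "eventually (\<lambda>n. indicator (B n) (x + t n) *\<^sub>R f x = indicator K x *\<^sub>R f x) sequentially"
      proof (cases "x \<in> K")
        case True
        then have "x + t n \<in> B n" for n using t(1)[of n] unfolding B_iff by (intro bexI[of _ x]) auto
        then show ?thesis using True by simp
      next
        case False
        \<comment> \<open>When \<open>x + t n\<close> lies in \<open>B n\<close>, \<open>v n\<close>
          is its displacement from a point of \<open>K\<close>; otherwise it is 0. As
          \<open>v n\<close> is in \<open>V n\<close>, it tends to 0, so
          \<open>x + t n - v n\<close> tends to \<open>x\<close> and eventually avoids the closed
          set \<open>K\<close>.\<close>
        define v where "v n = (if \<exists>k\<in>K. x + t n - k \<in> V n then x + t n - (SOME k. k \<in> K \<and> x + t n - k \<in> V n) else 0)" for n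
        have v: "v n \<in> V n \<and> (x + t n \<in> B n \<longrightarrow> x + t n - v n \<in> K)" for n
        proof (cases "\<exists>k\<in>K. x + t n - k \<in> V n")
          case True
          then have "\<exists>k. k \<in> K \<and> x + t n - k \<in> V n" by blast
          from someI_ex[OF this] show ?thesis using True by (auto simp: v_def)
        next
          case False
          then show ?thesis using V(2) by (auto simp: v_def B_iff)
        qed
        then have "v \<longlonglongrightarrow> 0" by (intro A(3)) (auto simp: V_def)
        then have "(\<lambda>n. x + t n - v n) \<longlonglongrightarrow> x + 0 - 0" by (intro tendsto_intros t0)
        then have "eventually (\<lambda>n. x + t n - v n \<in> - K) sequentially"
          using False K by (intro topological_tendstoD) (auto simp: open_Compl compact_imp_closed)
        then show ?thesis
        proof eventually_elim
          case (elim n)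
          then have "x + t n \<notin> B n" using v[of n] by blast
          then show ?case using False by simp
        qed
      qed
      then show "(\<lambda>n. indicator (B n) (x + t n) *\<^sub>R f x) \<longlonglongrightarrow> indicator K x *\<^sub>R f x"
        by (rule tendsto_eventually)
    qed
  qed measurable
  then show ?thesis using t(2) by (simp add: LIMSEQ_const_iff)
qed

text \<open>On a compact \<open>C\<close> the positive and negative parts of \<open>g\<close> are
  densities of finite measures. These agree on closed sets \<open>X\<close> because
  \<open>C \<inter> X\<close> is compact, hence on all Borel sets, and so the densities agree almost
  everywhere.\<close>

lemma AE_zero_of_compact_integrals_real:
  fixes g :: "'a \<Rightarrow> real"
  assumes g[measurable]: "g \<in> borel_measurable borel"
    and int: "\<And>C. compact C \<Longrightarrow> integrable \<mu> (\<lambda>x. indicator C x *\<^sub>R g x)"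
    and zero: "\<And>C. compact C \<Longrightarrow> (LINT x|\<mu>. indicator C x *\<^sub>R g x) = 0"
  shows "AE x in \<mu>. g x = 0"
proof -
  have on_compact: "AE x in \<mu>. x \<in> C \<longrightarrow> g x = 0" if C: "compact C" for C
  proof -
    have [measurable]: "C \<in> sets borel" by (rule borel_compact[OF C])
    \<comment> \<open>Since \<open>ennreal\<close> sends negative reals to 0, \<open>u 1\<close> and
      \<open>u (-1)\<close> are the positive and negative parts of \<open>g\<close> on
      \<open>C\<close>.\<close>
    define u where "u s x = ennreal (indicator C x * (s * g x))" for s :: real and x
    have [measurable]: "u s \<in> borel_measurable borel" for s unfolding u_def by measurable
    have closed_eq: "emeasure (density \<mu> (u 1)) X = emeasure (density \<mu> (u (-1))) X" if X: "closed X" for X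
    proof -
      have [measurable]: "X \<in> sets borel" using X by auto
      have CX: "compact (C \<inter> X)" by (rule compact_Int_closed[OF C X])
      let ?h = "\<lambda>x. indicator (C \<inter> X) x *\<^sub>R g x"
      have *: "emeasure (density \<mu> (u s)) X = ennreal (LINT x|\<mu>. max 0 (s * ?h x))" for s
      proof -
        have "emeasure (density \<mu> (u s)) X = (\<integral>\<^sup>+x. ennreal (max 0 (s * ?h x)) \<partial>\<mu>)"
          unfolding u_def
          by (subst emeasure_density) (auto intro!: nn_integral_cong simp: indicator_def max_def ennreal_neg)
        also have "\<dots> = ennreal (LINT x|\<mu>. max 0 (s * ?h x))"
          using int[OF CX] by (intro nn_integral_eq_integral integrable_max integrable_mult_right) auto
        finally show ?thesis .
      qed
      have "(LINT x|\<mu>. max 0 (1 * ?h x)) - (LINT x|\<mu>. max 0 (-1 * ?h x)) =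
          (LINT x|\<mu>. max 0 (1 * ?h x) - max 0 (-1 * ?h x))"
        using int[OF CX] by (intro Bochner_Integration.integral_diff[symmetric] integrable_max integrable_mult_right) auto
      also have "\<dots> = (LINT x|\<mu>. ?h x)"
        by (intro Bochner_Integration.integral_cong refl) (auto simp: max_def)
      also have "\<dots> = 0" by (rule zero[OF CX])
      finally show ?thesis unfolding * by simp
    qed
    have fin: "emeasure (density \<mu> (u 1)) UNIV \<noteq> \<infinity>"
    proof -
      have "emeasure (density \<mu> (u 1)) UNIV \<le> (\<integral>\<^sup>+x. ennreal (norm (indicator C x *\<^sub>R g x)) \<partial>\<mu>)"
        unfolding u_def by (subst emeasure_density) (auto intro!: nn_integral_mono ennreal_leI simp: indicator_def)
      also have "\<dots> < \<infinity>" using int[OF C] by (simp add: integrable_iff_bounded)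
      finally show ?thesis by simp
    qed
    have "density \<mu> (u 1) = density \<mu> (u (-1))"
      by (rule measure_eqI_generator_eq[where E = "Collect closed" and \<Omega> = UNIV and A = "\<lambda>_. UNIV"])
        (use fin closed_eq in \<open>auto simp: Int_stable_def sets_eq_borel borel_eq_closed\<close>)
    then have "AE x in \<mu>. u 1 x = u (-1) x"
      by (intro density_unique) auto
    then show ?thesis
    proof eventually_elim
      case (elim x)
      show ?case
      proof
        assume x: "x \<in> C"
        then have eq: "ennreal (g x) = ennreal (- g x)" using elim by (simp add: u_def)
        show "g x = 0"
        proof (cases "g x \<ge> 0")
          case True
          then have "ennreal (g x) = 0" using eq by (simp add: ennreal_neg)
          then show ?thesis using True by (simp add: ennreal_eq_0_iff)
        next
          case False
          then have "ennreal (- g x) = 0" using eq by (simp add: ennreal_neg)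
          then show ?thesis using False by (simp add: ennreal_eq_0_iff)
        qed
      qed
    qed
  qed
  obtain \<C> where C: "countable \<C>" "\<And>C. C \<in> \<C> \<Longrightarrow> compact C" "\<Union>\<C> = (UNIV :: 'a set)"
    using compact_nhd countable_compact_cover by metis
  have "AE x in \<mu>. \<forall>C\<in>\<C>. x \<in> C \<longrightarrow> g x = 0"
    using C(1,2) on_compact by (subst AE_ball_countable) auto
  then show ?thesis
  proof eventually_elim
    case (elim x)
    moreover have "x \<in> \<Union>\<C>" using C(3) by simp
    ultimately show ?case by blast
  qed
qed

lemma AE_zero_of_compact_integrals:
  fixes f :: "'a \<Rightarrow> complex"
  assumes f[measurable]: "f \<in> borel_measurable borel"
    and int: "\<And>C. compact C \<Longrightarrow> integrable \<mu> (\<lambda>x. indicator C x *\<^sub>R f x)"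
    and zero: "\<And>C. compact C \<Longrightarrow> (LINT x|\<mu>. indicator C x *\<^sub>R f x) = 0"
  shows "AE x in \<mu>. f x = 0"
proof -
  have "AE x in \<mu>. Re (f x) = 0"
  proof (rule AE_zero_of_compact_integrals_real)
    fix C :: "'a set" assume C: "compact C"
    show "integrable \<mu> (\<lambda>x. indicator C x *\<^sub>R Re (f x))"
      using integrable_Re[OF int[OF C]] by simp
    show "(LINT x|\<mu>. indicator C x *\<^sub>R Re (f x)) = 0"
      using integral_Re[OF int[OF C]] zero[OF C] by simp
  qed measurable
  moreover have "AE x in \<mu>. Im (f x) = 0"
  proof (rule AE_zero_of_compact_integrals_real)
    fix C :: "'a set" assume C: "compact C"
    show "integrable \<mu> (\<lambda>x. indicator C x *\<^sub>R Im (f x))"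
      using integrable_Im[OF int[OF C]] by simp
    show "(LINT x|\<mu>. indicator C x *\<^sub>R Im (f x)) = 0"
      using integral_Im[OF int[OF C]] zero[OF C] by simp
  qed measurable
  ultimately show ?thesis by eventually_elim (simp add: complex_eq_iff)
qed

text \<open>With \<open>f\<close> at the vertex \<open>{}\<close> and the indicator of an open
  \<open>B\<close> at \<open>{0}\<close>, the Gowers--Cauchy--Schwarz bound contains the vanishing
  factor of \<open>f\<close>. So the correlation vanishes almost everywhere, and
  \<open>integral_compact_eq_0\<close> turns this into vanishing integrals over compact
  sets.\<close>

lemma N_family_1_definite:
  assumes f[measurable]: "f \<in> borel_measurable borel" and p: "p > 0" "even p"
    and fin: "N_abs 1 p (\<lambda>_. f) < \<infinity>" and zero: "N_family 1 p (\<lambda>_. f) = 0"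
  shows "AE x in \<mu>. f x = 0"
proof -
  \<comment> \<open>The vertex \<open>{}\<close> enters the correlation conjugated, so the
    indicators test \<open>cnj f\<close>.\<close>
  have "AE x in \<mu>. cnj (f x) = 0"
  proof (rule AE_zero_of_compact_integrals)
    have fin': "N_abs 1 p (\<lambda>_ x. cnj (f x)) < \<infinity>"
    proof -
      have "N_abs 1 p (\<lambda>_ x. cnj (f x)) = N_abs 1 p (\<lambda>_. f)"
        by (subst (1 2) N_abs_1) simp_all
      then show ?thesis using fin by simp
    qed
    show int: "integrable \<mu> (\<lambda>x. indicator C x *\<^sub>R cnj (f x))" if "compact C" for C
      by (rule locally_integrable[OF _ fin' p(1) that]) measurable
    show "(LINT x|\<mu>. indicator C x *\<^sub>R cnj (f x)) = 0" if "compact C" for C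
    proof (rule integral_compact_eq_0[OF _ int _ that])
      fix B :: "'a set" assume B: "open B" "emeasure \<mu> B < \<infinity>"
      have [measurable]: "B \<in> sets borel" using B by auto
      define F where "F = (\<lambda>S::nat set. if S = {} then f else indicator B)"
      have F: "F S \<in> borel_measurable borel" "N_abs 1 p (\<lambda>_. F S) < \<infinity>" for S
        using fin N_abs_1_indicator_finite[OF _ B(2) p(1)] by (auto simp: F_def)
      have "N_family 1 p F ^ (2 ^ 1) \<le> (\<Prod>T\<in>Pow {..<1}. N_family 1 p (\<lambda>_. F T))"
        by (rule N_family_Gowers_Cauchy_Schwarz[OF F p])
      also have "\<dots> = 0"
        using zero by (auto simp: F_def intro!: prod_zero)
      finally have "N_family 1 p F = 0" by simp
      moreover have "N_family 1 p F = (\<integral>\<^sup>+t. ennreal (cmod (LINT x|\<mu>. indicator B (x + t) *\<^sub>R cnj (f x)) ^ p) \<partial>\<mu>)"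
      proof -
        have eq: "cnj (f x) * indicator B y = indicator B y *\<^sub>R cnj (f x)" for x y
          by (simp add: indicator_def)
        show ?thesis by (subst N_family_1[OF F(1)]) (simp add: F_def eq)
      qed
      ultimately have "AE t in \<mu>. ennreal (cmod (LINT x|\<mu>. indicator B (x + t) *\<^sub>R cnj (f x)) ^ p) = 0"
        by (simp add: nn_integral_0_iff_AE)
      then show "AE t in \<mu>. (LINT x|\<mu>. indicator B (x + t) *\<^sub>R cnj (f x)) = 0"
      proof eventually_elim
        case (elim t)
        then have "cmod (LINT x|\<mu>. indicator B (x + t) *\<^sub>R cnj (f x)) ^ p = 0"
          by (metis ennreal_eq_0_iff order_antisym zero_le_power norm_ge_zero)
        then show ?case by (metis norm_eq_zero power_eq_0_iff)
      qed
    qed measurable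
  qed measurable
  then show ?thesis by simp
qed

text \<open>The induction starts at \<open>d = 1\<close>, since for \<open>d = 0\<close> the
  functional sees only the modulus of the integral of \<open>f\<close>. In the induction step almost
  every multiplicative derivative inherits both finiteness and vanishing.\<close>

lemma N_family_definite:
  assumes "f \<in> borel_measurable borel" "N_abs d p (\<lambda>_. f) < \<infinity>" "N_family d p (\<lambda>_. f) = 0"
    and p: "p > 0" "even p" and d: "d \<ge> 1"
  shows "AE x in \<mu>. f x = 0"
  using d assms(1,2,3)
proof (induction d arbitrary: f rule: dec_induct)
  case base
  then show ?case using N_family_1_definite p by blast
next
  case (step d)
  note step.prems(1)[measurable]
  have "AE t in \<mu>. N_family d p (\<lambda>_ x. cnj (f x) * f (x + t)) = 0"
    using step.prems(3) N_family_Suc(2)[OF step.prems(1), of d p]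
    by (simp add: N_family_Suc(1)[OF step.prems(1)] nn_integral_0_iff_AE)
  moreover have "AE t in \<mu>. N_abs d p (\<lambda>_ x. cnj (f x) * f (x + t)) \<noteq> \<infinity>"
    using step.prems(2) N_abs_Suc(2)[OF step.prems(1), of d p]
    unfolding N_abs_Suc(1)[OF step.prems(1)] by (intro nn_integral_PInf_AE) auto
  ultimately have "AE t in \<mu>. AE x in \<mu>. cnj (f x) * f (x + t) = 0"
  proof eventually_elim
    case (elim t)
    show ?case by (rule step.IH) (use elim in \<open>simp_all add: less_top\<close>)
  qed
  then show ?case by (rule AE_zero_of_translates[OF step.prems(1)])
qed

end

section \<open>Norms on almost everywhere equivalence classes\<close>

lemma equiv_ae_eq: "equiv (borel_measurable M) (ae_eq M)"
proof (rule equivI)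
  show "ae_eq M \<subseteq> borel_measurable M \<times> borel_measurable M" by (auto simp: ae_eq_def)
  show "refl_on (borel_measurable M) (ae_eq M)" by (auto simp: refl_on_def ae_eq_def)
  show "sym (ae_eq M)" by (auto simp: sym_def ae_eq_def elim: eventually_mono)
  show "trans (ae_eq M)"
  proof (rule transI)
    fix f g h assume "(f, g) \<in> ae_eq M" "(g, h) \<in> ae_eq M"
    then show "(f, h) \<in> ae_eq M" by (auto simp: ae_eq_def elim: eventually_elim2)
  qed
qed

lemma cring_complex_field: "cring complex_field"
proof (rule cringI)
  show "abelian_group complex_field"
    by (rule abelian_groupI) (auto simp: complex_field_def intro: exI[of _ "- x" for x])
  show "comm_monoid complex_field"
    by (rule comm_monoidI) (auto simp: complex_field_def)
qed (auto simp: complex_field_def algebra_simps)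

text \<open>\<open>ae_closed\<close> makes \<open>F\<close> a union of full classes, so that every
  representative of a class of \<open>F\<close> lies in \<open>F\<close> again.\<close>

locale ae_function_space =
  fixes M :: "'a measure" and F :: "('a \<Rightarrow> complex) set"
  assumes measurable: "F \<subseteq> borel_measurable M"
    and zero: "(\<lambda>_. 0) \<in> F"
    and add: "\<And>f g. f \<in> F \<Longrightarrow> g \<in> F \<Longrightarrow> (\<lambda>x. f x + g x) \<in> F"
    and scale: "\<And>c f. f \<in> F \<Longrightarrow> (\<lambda>x. c * f x) \<in> F"
    and ae_closed: "\<And>f g. f \<in> F \<Longrightarrow> (f, g) \<in> ae_eq M \<Longrightarrow> g \<in> F"
begin

abbreviation cls :: "('a \<Rightarrow> complex) \<Rightarrow> ('a \<Rightarrow> complex) set" where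
  "cls f \<equiv> ae_eq M `` {f}"

lemma self_in_cls: "f \<in> F \<Longrightarrow> f \<in> cls f"
  using measurable by (auto simp: ae_eq_def)

lemma cls_eq_iff: "f \<in> F \<Longrightarrow> g \<in> F \<Longrightarrow> cls f = cls g \<longleftrightarrow> (AE x in M. f x = g x)"
  using eq_equiv_class_iff[OF equiv_ae_eq, of f M g] measurable by (auto simp: ae_eq_def subset_iff)

lemma cls_cong: "(f, g) \<in> ae_eq M \<Longrightarrow> cls f = cls g"
  by (rule equiv_class_eq[OF equiv_ae_eq])

lemma add_cls:
  assumes "f \<in> F" "g \<in> F"
  shows "cls f \<oplus>\<^bsub>ae_classes M F\<^esub> cls g = cls (\<lambda>x. f x + g x)"
proof -
  have "cls (\<lambda>x. f' x + g' x) = cls (\<lambda>x. f x + g x)" if "f' \<in> cls f" "g' \<in> cls g" for f' g'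
    using that by (intro cls_cong) (auto simp: ae_eq_def elim: eventually_elim2)
  then have "(\<Union>f\<in>cls f. \<Union>g\<in>cls g. cls (\<lambda>x. f x + g x)) = cls (\<lambda>x. f x + g x)"
    using self_in_cls[OF assms(1)] self_in_cls[OF assms(2)] by blast
  then show ?thesis unfolding ae_classes_def by simp
qed

lemma scale_cls:
  assumes "f \<in> F"
  shows "c \<odot>\<^bsub>ae_classes M F\<^esub> cls f = cls (\<lambda>x. c * f x)"
proof -
  have "cls (\<lambda>x. c * f' x) = cls (\<lambda>x. c * f x)" if "f' \<in> cls f" for f'
  proof (rule cls_cong)
    have "AE x in M. f x = f' x" "f \<in> borel_measurable M" "f' \<in> borel_measurable M"
      using that by (auto simp: ae_eq_def)
    moreover from this(1) have "AE x in M. c * f' x = c * f x" by eventually_elim simp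
    ultimately show "(\<lambda>x. c * f' x, \<lambda>x. c * f x) \<in> ae_eq M" by (simp add: ae_eq_def)
  qed
  then have "(\<Union>f\<in>cls f. cls (\<lambda>x. c * f x)) = cls (\<lambda>x. c * f x)"
    using self_in_cls[OF assms] by blast
  then show ?thesis unfolding ae_classes_def by simp
qed

lemma zero_cls: "\<zero>\<^bsub>ae_classes M F\<^esub> = cls (\<lambda>_. 0)"
  by (simp add: ae_classes_def)

lemma cls_in_carrier: "f \<in> F \<Longrightarrow> cls f \<in> carrier (ae_classes M F)"
  by (simp add: ae_classes_def quotientI)

lemma carrierE:
  assumes "A \<in> carrier (ae_classes M F)"
  obtains f where "f \<in> F" "A = cls f"
  using assms by (auto simp: ae_classes_def elim: quotientE)

lemma module_ae_classes: "Module.module complex_field (ae_classes M F)"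
proof (rule moduleI)
  show "cring complex_field" by (rule cring_complex_field)
  show "abelian_group (ae_classes M F)"
  proof (rule abelian_groupI)
    fix A assume "A \<in> carrier (ae_classes M F)"
    then obtain f where f: "f \<in> F" "A = cls f" by (rule carrierE)
    have m: "(\<lambda>x. - f x) \<in> F" using scale[OF f(1), of "-1"] by simp
    then have "cls (\<lambda>x. - f x) \<oplus>\<^bsub>ae_classes M F\<^esub> A = \<zero>\<^bsub>ae_classes M F\<^esub>"
      using f by (simp only: add_cls zero_cls) simp
    then show "\<exists>B\<in>carrier (ae_classes M F). B \<oplus>\<^bsub>ae_classes M F\<^esub> A = \<zero>\<^bsub>ae_classes M F\<^esub>"
      using cls_in_carrier[OF m] by blast
  qed (auto simp only: add_cls zero_cls zero add add.assoc add.commute add_0_left add.left_commute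
    intro!: cls_in_carrier elim!: carrierE)
qed (auto simp only: complex_field_def partial_object.simps monoid.simps ring.simps
      add_cls scale_cls zero add scale algebra_simps mult_1_left
    intro!: cls_in_carrier elim!: carrierE)

text \<open>
  The hypothesis \<open>subadd\<close> is the triangle inequality for the \<open>k\<close>-th root of \<open>N\<close>, stated without roots.
\<close>

lemma norm_on_ae_classes_root:
  fixes N :: "('a \<Rightarrow> complex) \<Rightarrow> ennreal"
  assumes k: "k > 0"
    and fin: "\<And>f. f \<in> F \<Longrightarrow> N f < \<infinity>"
    and cong: "\<And>f g. f \<in> F \<Longrightarrow> (f, g) \<in> ae_eq M \<Longrightarrow> N f = N g"
    and subadd: "\<And>f g a b. \<lbrakk>f \<in> F; g \<in> F; a > 0; b > 0; N f \<le> ennreal (a ^ k); N g \<le> ennreal (b ^ k)\<rbrakk>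
      \<Longrightarrow> N (\<lambda>x. f x + g x) \<le> ennreal ((a + b) ^ k)"
    and homog: "\<And>c f. f \<in> F \<Longrightarrow> N (\<lambda>x. c * f x) = ennreal (cmod c ^ k) * N f"
    and definite: "\<And>f. f \<in> F \<Longrightarrow> N f = 0 \<Longrightarrow> AE x in M. f x = 0"
  shows "norm_on_ae_classes M F (\<lambda>f. ennreal_powr (N f) (1 / real k))"
proof -
  define U where "U f = root k (enn2real (N f))" for f
  have U_nonneg: "U f \<ge> 0" for f by (simp add: U_def k)
  have U_pow: "ennreal (U f ^ k) = N f" if "f \<in> F" for f
    using fin[OF that] k by (simp add: U_def real_root_pow_pos2 less_top)
  have U_le: "U f \<le> a" if "N f \<le> ennreal (a ^ k)" "a \<ge> 0" for f a
  proof -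
    have "enn2real (N f) \<le> a ^ k" using that by (intro enn2real_leI) auto
    then show ?thesis unfolding U_def using that(2) k
      by (metis real_root_le_iff real_root_power_cancel)
  qed
  have U_powr: "ennreal_powr (N f) (1 / real k) = ennreal (U f)" if "f \<in> F" for f
    using fin[OF that] k by (auto simp: ennreal_powr_def U_def root_powr_inverse)
  have U_add: "U (\<lambda>x. f x + g x) \<le> U f + U g" if "f \<in> F" "g \<in> F" for f g
  \<comment> \<open>\<open>subadd\<close> asks for strictly positive bounds, while
    \<open>U f\<close> and \<open>U g\<close> may be 0; hence the margin \<open>e / 2\<close> for
    each.\<close>
  proof (rule field_le_epsilon)
    fix e :: real assume e: "e > 0"
    have le: "N f \<le> ennreal ((U f + e / 2) ^ k)" if "f \<in> F" for f
      unfolding U_pow[OF that, symmetric] using e U_nonneg[of f]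
      by (intro ennreal_leI power_mono) auto
    have "N (\<lambda>x. f x + g x) \<le> ennreal (((U f + e / 2) + (U g + e / 2)) ^ k)"
      using that e U_nonneg[of f] U_nonneg[of g] by (intro subadd le) auto
    then have "U (\<lambda>x. f x + g x) \<le> (U f + e / 2) + (U g + e / 2)"
      using e U_nonneg[of f] U_nonneg[of g] by (intro U_le) auto
    then show "U (\<lambda>x. f x + g x) \<le> U f + U g + e" by simp
  qed
  have U_scale: "U (\<lambda>x. c * f x) = cmod c * U f" if "f \<in> F" for c f
    using k by (simp add: U_def homog[OF that] enn2real_mult real_root_mult real_root_power_cancel)
  have U_0: "U (\<lambda>_. 0) = 0"
    using U_scale[OF zero, of 0] by simp
  have U_cong: "U f = U g" if "f \<in> F" "(f, g) \<in> ae_eq M" for f g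
    using cong[OF that] by (simp add: U_def)
  have U_definite: "U f = 0 \<longleftrightarrow> (AE x in M. f x = 0)" if "f \<in> F" for f
  proof
    assume "U f = 0"
    then have "N f = 0" using U_pow[OF that] k by (simp add: zero_power)
    then show "AE x in M. f x = 0" by (rule definite[OF that])
  next
    assume "AE x in M. f x = 0"
    then have "(f, \<lambda>_. 0) \<in> ae_eq M" using that measurable by (auto simp: ae_eq_def)
    then show "U f = 0" using U_cong[OF that] U_0 by simp
  qed
  define \<nu> where "\<nu> A = U (SOME f. f \<in> A)" for A
  have \<nu>: "\<nu> (cls f) = U f" if f: "f \<in> F" for f
  proof -
    have "(SOME g. g \<in> cls f) \<in> cls f" by (rule someI[of "\<lambda>g. g \<in> cls f", OF self_in_cls[OF f]])
    then show ?thesis unfolding \<nu>_def using U_cong[OF f] by (metis ImageE singletonD)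
  qed
  have "is_norm (ae_classes M F) \<nu>"
    unfolding is_norm_def
  proof (intro conjI ballI allI)
    show "Module.module complex_field (ae_classes M F)" by (rule module_ae_classes)
    fix A assume "A \<in> carrier (ae_classes M F)"
    then obtain f where f: "f \<in> F" "A = cls f" by (rule carrierE)
    show "0 \<le> \<nu> A" using f by (simp add: \<nu> U_nonneg)
    show "\<nu> A = 0 \<longleftrightarrow> A = \<zero>\<^bsub>ae_classes M F\<^esub>"
      using f zero by (simp add: \<nu> U_definite zero_cls cls_eq_iff)
    show "\<nu> (c \<odot>\<^bsub>ae_classes M F\<^esub> A) = cmod c * \<nu> A" for c
      using f by (simp add: scale_cls \<nu> scale U_scale)
    fix B assume "B \<in> carrier (ae_classes M F)"
    then obtain g where g: "g \<in> F" "B = cls g" by (rule carrierE)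
    show "\<nu> (A \<oplus>\<^bsub>ae_classes M F\<^esub> B) \<le> \<nu> A + \<nu> B"
      using f g by (simp add: add_cls \<nu> add U_add)
  qed
  moreover have "ennreal_powr (N f) (1 / real k) = ennreal (\<nu> A)" if "A \<in> F // ae_eq M" "f \<in> A" for A f
  proof -
    have "A \<in> carrier (ae_classes M F)" using that(1) by (simp add: ae_classes_def)
    then obtain g where g: "g \<in> F" "A = cls g" by (rule carrierE)
    then have gf: "(g, f) \<in> ae_eq M" using that(2) by simp
    then have "f \<in> F" by (rule ae_closed[OF g(1)])
    then show ?thesis using U_powr U_cong[OF g(1) gf] \<nu>[OF g(1)] g(2) by simp
  qed
  ultimately show ?thesis unfolding norm_on_ae_classes_def by blast
qed

end

section \<open>From \<open>N_abs\<close> and \<open>N_family\<close> back to the U norms\<close>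

lemma ennreal_powr_nat: "p > 0 \<Longrightarrow> ennreal_powr x (real p) = x ^ p"
proof -
  assume p: "p > 0"
  show ?thesis
  proof (cases "x = \<infinity>")
    case False
    then obtain r where "x = ennreal r" "r \<ge> 0" by (metis ennreal_cases infinity_ennreal_def)
    then show ?thesis using p by (cases "r = 0") (simp_all add: ennreal_powr_def powr_realpow ennreal_power zero_power)
  qed (use p in \<open>simp add: ennreal_powr_def\<close>)
qed

context translation_invariant_measure
begin

lemma borel_measurable_eq: "borel_measurable \<mu> = borel_measurable borel"
  by (rule measurable_cong_sets) (simp_all add: sets_eq_borel)

lemma U_norm_abs_eq:
  assumes "p > 0"
  shows "U_norm_abs \<mu> d (real p) f = ennreal_powr (N_abs d p (\<lambda>_. f)) (1 / real (2 ^ d * p))"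
proof -
  have "R_op_nn \<mu> d (\<lambda>x. ennreal (cmod (f x))) = R_abs d (\<lambda>_. f)"
    by (simp add: fun_eq_iff R_op_nn_def R_abs_def norm_cube_family prod_ennreal)
  then show ?thesis
    using assms by (simp add: U_norm_nn_def N_abs_def ennreal_powr_nat)
qed

lemma U_norm_eq:
  assumes "p > 0"
  shows "U_norm \<mu> d (real p) f = ennreal_powr (N_family d p (\<lambda>_. f)) (1 / real (2 ^ d * p))"
proof -
  have "ennreal (cmod z powr real p) = ennreal (cmod z) ^ p" for z
    using assms by (cases "z = 0") (simp_all add: powr_realpow ennreal_power zero_power)
  then show ?thesis
    by (simp add: U_norm_def N_family_def R_op_def R_family_def cube_family_const)
qed

lemma U_finite_eq:
  assumes "p > 0"
  shows "U_finite \<mu> d (real p) = {f \<in> borel_measurable borel. N_abs d p (\<lambda>_. f) < \<infinity>}"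
proof -
  have "ennreal_powr x a < \<infinity> \<longleftrightarrow> x < \<infinity>" for x a
    by (auto simp: ennreal_powr_def less_top)
  then show ?thesis
    unfolding U_finite_def U_norm_abs_eq[OF assms] borel_measurable_eq by blast
qed

text \<open>This holds for every \<open>h\<close>, because the cube involves only finitely many
  translates of one null set.\<close>

lemma cube_family_AE_cong:
  assumes "AE x in \<mu>. f x = g x"
  shows "AE x in \<mu>. cube_family d (\<lambda>_. f) h x = cube_family d (\<lambda>_. g) h x"
proof -
  have "AE x in \<mu>. \<forall>S\<in>Pow {..<d}. f (x + (\<Sum>i\<in>S. h i)) = g (x + (\<Sum>i\<in>S. h i))"
    using AE_translation[OF assms] by (intro AE_finite_allI) auto
  then show ?thesis by eventually_elim (simp add: cube_family_def)
qed

lemma N_abs_AE_cong: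
  assumes "AE x in \<mu>. f x = g x"
  shows "N_abs d p (\<lambda>_. f) = N_abs d p (\<lambda>_. g)"
proof -
  have "R_abs d (\<lambda>_. f) h = R_abs d (\<lambda>_. g) h" for h
    unfolding R_abs_def using cube_family_AE_cong[OF assms, of d h]
    by (intro nn_integral_cong_AE) (auto elim: eventually_mono)
  then show ?thesis by (simp add: N_abs_def)
qed

lemma N_family_AE_cong:
  assumes ae: "AE x in \<mu>. f x = g x" and m: "f \<in> borel_measurable borel" "g \<in> borel_measurable borel"
  shows "N_family d p (\<lambda>_. f) = N_family d p (\<lambda>_. g)"
  unfolding N_family_def R_family_def
proof (rule nn_integral_cong)
  fix h assume [measurable]: "h \<in> space (prod_measure d \<mu>)"
  note [measurable] = measurable_cube_family[where F = "\<lambda>_. f", OF m(1)]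
    measurable_cube_family[where F = "\<lambda>_. g", OF m(2)]
  have "integral\<^sup>L \<mu> (cube_family d (\<lambda>_. f) h) = integral\<^sup>L \<mu> (cube_family d (\<lambda>_. g) h)"
    by (rule integral_cong_AE) (auto intro: cube_family_AE_cong[OF ae])
  then show "ennreal (cmod (integral\<^sup>L \<mu> (cube_family d (\<lambda>_. f) h))) ^ p =
      ennreal (cmod (integral\<^sup>L \<mu> (cube_family d (\<lambda>_. g) h))) ^ p" by simp
qed

text \<open>The scalar \<open>\<gamma>\<close> collects one copy of \<open>c\<close> or
  \<open>cnj c\<close> per vertex; for homogeneity only its modulus matters.\<close>

lemma cube_family_scale:
  obtains \<gamma> where "cmod \<gamma> = cmod c ^ (2 ^ d)"
    "\<And>h. cube_family d (\<lambda>_ x. c * f x) h = (\<lambda>x. \<gamma> * cube_family d (\<lambda>_. f) h x)"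
proof (rule that)
  show "cmod (\<Prod>S\<in>Pow {..<d}. (cnj ^^ (d - card S)) c) = cmod c ^ (2 ^ d)"
    by (simp add: prod_norm[symmetric] card_Pow)
  show "cube_family d (\<lambda>_ x. c * f x) h = (\<lambda>x. (\<Prod>S\<in>Pow {..<d}. (cnj ^^ (d - card S)) c) * cube_family d (\<lambda>_. f) h x)" for h
    by (simp add: fun_eq_iff cube_family_def cnj_funpow_mult prod.distrib)
qed

lemma N_abs_scale:
  assumes f: "f \<in> borel_measurable borel"
  shows "N_abs d p (\<lambda>_ x. c * f x) = ennreal (cmod c ^ (2 ^ d * p)) * N_abs d p (\<lambda>_. f)"
proof -
  obtain \<gamma> where \<gamma>: "cmod \<gamma> = cmod c ^ (2 ^ d)"
    "\<And>h. cube_family d (\<lambda>_ x. c * f x) h = (\<lambda>x. \<gamma> * cube_family d (\<lambda>_. f) h x)"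
    using cube_family_scale[of c d f] by blast
  note [measurable] = measurable_cube_family[where F = "\<lambda>_. f", OF f]
    measurable_R(2)[where F = "\<lambda>_. f", OF f]
  have "R_abs d (\<lambda>_ x. c * f x) h = ennreal (cmod \<gamma>) * R_abs d (\<lambda>_. f) h"
    if [measurable]: "h \<in> space (prod_measure d \<mu>)" for h
    unfolding R_abs_def \<gamma>(2) norm_mult by (simp add: ennreal_mult nn_integral_cmult)
  then have "N_abs d p (\<lambda>_ x. c * f x) = (\<integral>\<^sup>+h. ennreal (cmod \<gamma>) ^ p * R_abs d (\<lambda>_. f) h ^ p \<partial>prod_measure d \<mu>)"
    unfolding N_abs_def by (intro nn_integral_cong) (simp add: power_mult_distrib)
  also have "\<dots> = ennreal (cmod \<gamma>) ^ p * N_abs d p (\<lambda>_. f)"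
    unfolding N_abs_def by (rule nn_integral_cmult) measurable
  finally show ?thesis by (simp add: \<gamma>(1) ennreal_power power_mult)
qed

lemma N_family_scale:
  assumes f: "f \<in> borel_measurable borel"
  shows "N_family d p (\<lambda>_ x. c * f x) = ennreal (cmod c ^ (2 ^ d * p)) * N_family d p (\<lambda>_. f)"
proof -
  obtain \<gamma> where \<gamma>: "cmod \<gamma> = cmod c ^ (2 ^ d)"
    "\<And>h. cube_family d (\<lambda>_ x. c * f x) h = (\<lambda>x. \<gamma> * cube_family d (\<lambda>_. f) h x)"
    using cube_family_scale[of c d f] by blast
  note [measurable] = measurable_R(1)[where F = "\<lambda>_. f", OF f]
  have "ennreal (cmod (R_family d (\<lambda>_ x. c * f x) h)) = ennreal (cmod \<gamma>) * ennreal (cmod (R_family d (\<lambda>_. f) h))" for h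
    unfolding R_family_def \<gamma>(2) by (simp add: norm_mult ennreal_mult)
  then have "N_family d p (\<lambda>_ x. c * f x) =
      (\<integral>\<^sup>+h. ennreal (cmod \<gamma>) ^ p * ennreal (cmod (R_family d (\<lambda>_. f) h)) ^ p \<partial>prod_measure d \<mu>)"
    unfolding N_family_def by (simp add: power_mult_distrib)
  also have "\<dots> = ennreal (cmod \<gamma>) ^ p * N_family d p (\<lambda>_. f)"
    unfolding N_family_def by (rule nn_integral_cmult) measurable
  finally show ?thesis by (simp add: \<gamma>(1) ennreal_power power_mult)
qed

lemma N_family_le_N_abs: "N_family d p F \<le> N_abs d p F"
  unfolding N_family_def N_abs_def R_family_def R_abs_def
  by (intro nn_integral_mono power_mono_ennreal norm_integral_le_nn_integral)

lemma ae_function_space_U_finite: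
  assumes p: "p > 0"
  shows "ae_function_space \<mu> (U_finite \<mu> d (real p))"
proof
  let ?K = "2 ^ d * p"
  \<comment> \<open>\<open>N_abs_add\<close> takes bounds of the form \<open>a ^ ?K\<close> with
    \<open>a > 0\<close>. The choice \<open>1 + r\<close> works because \<open>?K\<close> is at
    least 1, so the power is at least \<open>1 + r\<close>.\<close>
  have bound: "\<exists>a>0. N_abs d p (\<lambda>_. f) \<le> ennreal (a ^ ?K)" if "N_abs d p (\<lambda>_. f) < \<infinity>" for f
  proof -
    define r where "r = enn2real (N_abs d p (\<lambda>_. f))"
    have "N_abs d p (\<lambda>_. f) = ennreal r" using that by (simp add: r_def less_top)
    moreover have "r \<le> (1 + r) ^ ?K"
    proof -
      have "r \<ge> 0" by (simp add: r_def)
      then have "(1 + r) ^ 1 \<le> (1 + r) ^ ?K" using p by (intro power_increasing) auto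
      then show ?thesis by simp
    qed
    ultimately have "N_abs d p (\<lambda>_. f) \<le> ennreal ((1 + r) ^ ?K)"
      by (simp only: ennreal_leI)
    moreover have "1 + r > 0" by (simp add: r_def add_pos_nonneg)
    ultimately show ?thesis by blast
  qed
  show "(\<lambda>x. f x + g x) \<in> U_finite \<mu> d (real p)"
    if "f \<in> U_finite \<mu> d (real p)" "g \<in> U_finite \<mu> d (real p)" for f g
  proof -
    from that have fg: "f \<in> borel_measurable borel" "g \<in> borel_measurable borel"
      "N_abs d p (\<lambda>_. f) < \<infinity>" "N_abs d p (\<lambda>_. g) < \<infinity>"
      by (auto simp: U_finite_eq[OF p])
    obtain a b where "a > 0" "b > 0" "N_abs d p (\<lambda>_. f) \<le> ennreal (a ^ ?K)" "N_abs d p (\<lambda>_. g) \<le> ennreal (b ^ ?K)"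
      using bound fg(3,4) by blast
    then have "N_abs d p (\<lambda>_ x. f x + g x) \<le> ennreal ((a + b) ^ ?K)"
      by (intro N_abs_add fg p)
    also have "\<dots> < \<infinity>" by simp
    finally show ?thesis using fg(1,2) by (simp add: U_finite_eq[OF p])
  qed
  show scale: "(\<lambda>x. c * f x) \<in> U_finite \<mu> d (real p)" if "f \<in> U_finite \<mu> d (real p)" for c f
    using that by (auto simp: U_finite_eq[OF p] N_abs_scale ennreal_mult_less_top)
  have "N_abs d p (\<lambda>_ _. 0) = 0"
    using N_abs_scale[of "\<lambda>_. 0" d p 0] p by (simp add: zero_power)
  then show "(\<lambda>_. 0) \<in> U_finite \<mu> d (real p)"
    by (simp add: U_finite_eq[OF p])
  show "g \<in> U_finite \<mu> d (real p)" if "f \<in> U_finite \<mu> d (real p)" "(f, g) \<in> ae_eq \<mu>" for f g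
    using that N_abs_AE_cong[of f g d p] by (auto simp: U_finite_eq[OF p] ae_eq_def borel_measurable_eq)
qed (auto simp: U_finite_def)

lemma U_norm_abs_is_norm:
  assumes p: "p > 0"
  shows "norm_on_ae_classes \<mu> (U_finite \<mu> d (real p)) (U_norm_abs \<mu> d (real p))"
proof -
  interpret V: ae_function_space \<mu> "U_finite \<mu> d (real p)" by (rule ae_function_space_U_finite[OF p])
  show ?thesis
    unfolding U_norm_abs_eq[OF p]
  proof (rule V.norm_on_ae_classes_root)
    show "N_abs d p (\<lambda>_. f) = N_abs d p (\<lambda>_. g)" if "(f, g) \<in> ae_eq \<mu>" for f g
      using that by (intro N_abs_AE_cong) (simp add: ae_eq_def)
  qed (use p in \<open>auto simp: U_finite_eq[OF p] intro: N_abs_add N_abs_scale N_abs_definite\<close>)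
qed

end

lemma (in haar_space) U_norm_is_norm:
  assumes p: "p > 0" "even p" and d: "d \<ge> 1"
  shows "norm_on_ae_classes \<mu> (U_finite \<mu> d (real p)) (U_norm \<mu> d (real p))"
proof -
  interpret V: ae_function_space \<mu> "U_finite \<mu> d (real p)" by (rule ae_function_space_U_finite[OF p(1)])
  show ?thesis
    unfolding U_norm_eq[OF p(1)]
  proof (rule V.norm_on_ae_classes_root)
    show "N_family d p (\<lambda>_. f) = N_family d p (\<lambda>_. g)" if "(f, g) \<in> ae_eq \<mu>" for f g
      using that by (intro N_family_AE_cong) (simp_all add: ae_eq_def borel_measurable_eq)
    show "N_family d p (\<lambda>_. f) < \<infinity>" if "f \<in> U_finite \<mu> d (real p)" for f
      using that by (auto simp: U_finite_eq[OF p(1)] intro: le_less_trans[OF N_family_le_N_abs])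
  qed (use p d in \<open>auto simp: U_finite_eq[OF p(1)] intro: N_family_add N_family_scale N_family_definite\<close>)
qed

text \<open>Sigma-finiteness comes from a countable cover by compact sets, and invariance of
  \<open>distr\<close> from writing the preimage under a translation as the image under the opposite
  one.\<close>

lemma haar_space_if_haar_measure:
  fixes \<mu> :: "'a::{topological_ab_group_add, second_countable_topology, t2_space} measure"
  assumes lc: "locally_compact_space (euclidean :: 'a topology)" and haar: "haar_measure \<mu>"
  shows "haar_space \<mu>"
proof -
  have sets: "sets \<mu> = sets borel" and nonzero: "emeasure \<mu> UNIV \<noteq> 0"
    and inv: "\<And>a A. A \<in> sets borel \<Longrightarrow> emeasure \<mu> ((\<lambda>x. a + x) ` A) = emeasure \<mu> A"
    and fin: "\<And>K. compact K \<Longrightarrow> emeasure \<mu> K < \<infinity>"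
    using haar by (auto simp: haar_measure_def)
  obtain W K where WK: "open W" "compact K" "(0::'a) \<in> W" "W \<subseteq> K"
    using lc unfolding locally_compact_space_def by (auto simp: compactin_euclidean_iff) blast
  obtain \<C> where C: "countable \<C>" "\<And>C. C \<in> \<C> \<Longrightarrow> compact C" "\<Union>\<C> = (UNIV :: 'a set)"
    using countable_compact_cover[OF WK] by blast
  have sp: "space \<mu> = UNIV" using sets_eq_imp_space_eq[OF sets] by simp
  interpret sigma_finite_measure \<mu>
  proof
    show "\<exists>A. countable A \<and> A \<subseteq> sets \<mu> \<and> \<Union> A = space \<mu> \<and> (\<forall>a\<in>A. emeasure \<mu> a \<noteq> \<infinity>)"
      using C fin by (intro exI[of _ \<C>]) (auto simp: sets sp less_top intro: compact_imp_closed borel_closed)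
  qed
  show ?thesis
  proof
    show "distr \<mu> borel (\<lambda>x. x + a) = \<mu>" for a
    proof (rule measure_eqI)
      fix A assume "A \<in> sets (distr \<mu> borel (\<lambda>x. x + a))"
      then have A: "A \<in> sets borel" by simp
      have m: "(\<lambda>x. x + a) \<in> measurable \<mu> borel"
        using sets by (simp add: measurable_cong_sets[OF sets refl])
      have "(\<lambda>x. x + a) -` A = (\<lambda>x. - a + x) ` A"
      proof (intro equalityI subsetI)
        fix x assume "x \<in> (\<lambda>x. x + a) -` A"
        then show "x \<in> (\<lambda>x. - a + x) ` A" by (intro image_eqI[of _ _ "x + a"]) auto
      qed auto
      then show "emeasure (distr \<mu> borel (\<lambda>x. x + a)) A = emeasure \<mu> A"
        using inv[OF A, of "- a"] by (simp add: emeasure_distr[OF m A] sp)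
    qed (simp add: sets)
  qed (use sets nonzero fin WK in auto)
qed

theorem corollaryA2:
  fixes \<mu> :: "'a::{topological_ab_group_add, second_countable_topology, t2_space} measure"
  assumes "locally_compact_space (euclidean :: 'a topology)"
    and "haar_measure \<mu>"
  shows "(\<forall>d p :: nat. d \<ge> 2 \<longrightarrow> p > 0 \<longrightarrow>
            norm_on_ae_classes \<mu> (U_finite \<mu> d (real p)) (U_norm_abs \<mu> d (real p))) \<and>
         (\<forall>d p :: nat. d \<ge> 1 \<longrightarrow> p > 0 \<longrightarrow> even p \<longrightarrow>
            (\<forall>f \<in> U_finite \<mu> d (real p).
               AE h in prod_measure d \<mu>. integrable \<mu> (cube_prod d f h)) \<and>
            norm_on_ae_classes \<mu> (U_finite \<mu> d (real p)) (U_norm \<mu> d (real p)))"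
proof -
  interpret haar_space \<mu> by (rule haar_space_if_haar_measure[OF assms])
  \<comment> \<open>This shows that the default value in \<open>R_op\<close> is met at most on a
    null set of \<open>h\<close>.\<close>
  have "AE h in prod_measure d \<mu>. integrable \<mu> (cube_prod d f h)"
    if p: "p > 0" and f: "f \<in> U_finite \<mu> d (real p)" for d p f
  proof -
    have f: "f \<in> borel_measurable borel" "N_abs d p (\<lambda>_. f) < \<infinity>"
      using f by (auto simp: U_finite_eq[OF p])
    note [measurable] = measurable_cube_family[where F = "\<lambda>_. f" and d = d, OF f(1)]
    have "AE h in prod_measure d \<mu>. R_abs d (\<lambda>_. f) h < \<infinity>"
      by (rule AE_R_abs_finite[OF f p])
    then show ?thesis
      using AE_space
    proof eventually_elim
      case (elim h)
      note elim(2)[measurable]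
      show ?case
        using elim(1) unfolding cube_family_const[symmetric] R_abs_def
        by (intro integrableI_bounded) auto
    qed
  qed
  then show ?thesis using U_norm_abs_is_norm U_norm_is_norm by blast
qed

end
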